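(* Let $G$ be a (finite, simple) graph with vertex set $X$. Then $\xi_{\mathrm{qc}}(G)\geq\sqrt{\dfrac{|X|}{\theta(G)}}$. Moreover, $\xi_{\mathrm q}(K_{d^2})=\xi_{\mathrm{qc}}(K_{d^2})=d$ for every $d\in\mathbb N$.
   Context: For vertices $x,y$, $x\sim y$ means that $\{x,y\}$ is an edge. $\theta(G)$ is the Lovász number of $G$ and $K_n$ is the complete graph on $n$ vertices. Notation: $M_A=\mathcal L(\mathbb C^A)$, $\mathcal D_X\subseteq M_X$ is the diagonal algebra, $\mathcal D_{XX}=\mathcal D_X\otimes\mathcal D_X$, $M_{AA}=M_A\otimes M_A$, $(e_x)$ is the canonical basis, $\xi\eta^*$ is the rank one operator $\zeta\mapsto\langle\zeta,\eta\rangle\xi$; the pairing on $M_{AA}$ is $\langle\rho,\omega\rangle=\mathrm{Tr}(\rho\omega^{\mathrm t})$; $\Omega_A=\sum_{a,b\in A}e_ae_b^*\otimes e_ae_b^*$. A CQNS correlation is a channel (completely positive trace preserving map) $\mathcal E:\mathcal D_{XX}\to M_{AA}$ such that, with $\sigma_{x,y}=\mathcal E(e_xe_x^*\otimes e_ye_y^* )$, the partial trace of $\sigma_{x,y}$ over the first (resp. second) tensor factor of $M_A\otimes M_A$ does not depend on $x$ (resp. $y$). It is tracial if there exist a unital C*-algebra $\mathcal A$, a trace (tracial state) $\tau$ on $\mathcal A$, and elements $g_{x,a,a'}\in\mathcal A$ such that, for each $x\in X$, $(g_{x,a,a'})_{a,a'}\in(M_A\otimes\mathcal A)^+$ and $\sum_ag_{x,a,a}=1$,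 with $$\mathcal E(e_xe_x^*\otimes e_ye_y^* )=\sum_{a,a',b,b'\in A}\tau(g_{x,a,a'}g_{y,b',b})\,e_ae_{a'}^*\otimes e_be_{b'}^*,\quad x,y\in X;$$ it is quantum tracial if $\mathcal A$ can be chosen finite dimensional. A CQNS correlation $\mathcal E$ is $G$-proper if $x\sim y\Rightarrow\langle\mathcal E(e_xe_x^*\otimes e_ye_y^* ),\Omega_A\rangle=0$. A quantum $\mathrm{qc}$-colouring (resp. quantum $\mathrm q$-colouring) of $G$ by a finite set $A$ is a $G$-proper CQNS correlation $\mathcal E:\mathcal D_{XX}\to M_{AA}$ that is tracial (resp. quantum tracial). For $\mathrm x\in\{\mathrm q,\mathrm{qc}\}$, $\xi_{\mathrm x}(G)=\min\{|A|:\text{there exists a quantum }\mathrm x\text{-colouring of }G\text{ by }A\}$. *)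

theory Defs
  imports
    "HOL-Analysis.Analysis"
    "HOL-Algebra.Module"
    "Graph_Theory.Graph_Theory"
begin

section \<open>Operators on finite-dimensional Hilbert spaces\<close>

text \<open>
  For a finite set \<open>I\<close>, an operator on \<open>\<complex>\<^sup>I\<close> is given by its matrix in the canonical basis, extended
  by \<open>0\<close> outside \<open>I \<times> I\<close>.  Tensor products are identified with product index sets, so
  \<open>M\<^sub>A \<otimes> M\<^sub>A\<close> is \<open>op_algebra (A \<times> A)\<close> and \<open>D\<^sub>X \<otimes> D\<^sub>X\<close> is \<open>diag_algebra (X \<times> X)\<close>.
\<close>

type_synonym 'i cmat = "'i \<Rightarrow> 'i \<Rightarrow> complex"

definition op_algebra :: "'i set \<Rightarrow> 'i cmat set" where
  "op_algebra I = {T. \<forall>i j. T i j \<noteq> 0 \<longrightarrow> i \<in> I \<and> j \<in> I}"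

definition diag_algebra :: "'i set \<Rightarrow> 'i cmat set" where
  "diag_algebra I = {T \<in> op_algebra I. \<forall>i j. i \<noteq> j \<longrightarrow> T i j = 0}"

text \<open>\<open>matrix_unit i j\<close> is the rank one operator \<open>e\<^sub>i e\<^sub>j\<^sup>*\<close>.\<close>

definition matrix_unit :: "'i \<Rightarrow> 'i \<Rightarrow> 'i cmat" where
  "matrix_unit i j = (\<lambda>k l. if k = i \<and> l = j then 1 else 0)"

definition tensor :: "'i cmat \<Rightarrow> 'j cmat \<Rightarrow> ('i \<times> 'j) cmat" where
  "tensor S T = (\<lambda>p q. S (fst p) (fst q) * T (snd p) (snd q))"

definition op_mult :: "'i set \<Rightarrow> 'i cmat \<Rightarrow> 'i cmat \<Rightarrow> 'i cmat" where
  "op_mult I S T = (\<lambda>i j. \<Sum>k\<in>I. S i k * T k j)"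

definition op_transpose :: "'i cmat \<Rightarrow> 'i cmat" where
  "op_transpose T = (\<lambda>i j. T j i)"

definition op_trace :: "'i set \<Rightarrow> 'i cmat \<Rightarrow> complex" where
  "op_trace I T = (\<Sum>i\<in>I. T i i)"

definition op_pairing :: "'i set \<Rightarrow> 'i cmat \<Rightarrow> 'i cmat \<Rightarrow> complex" where
  "op_pairing I S T = op_trace I (op_mult I S (op_transpose T))"

definition op_positive :: "'i set \<Rightarrow> 'i cmat \<Rightarrow> bool" where
  "op_positive I T \<longleftrightarrow>
     T \<in> op_algebra I \<and> (\<forall>v. (\<Sum>i\<in>I. \<Sum>j\<in>I. cnj (v i) * T i j * v j) \<in> \<real>\<^sub>\<ge>\<^sub>0)"

definition partial_trace_fst :: "'i set \<Rightarrow> ('i \<times> 'j) cmat \<Rightarrow> 'j cmat" where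
  "partial_trace_fst I T = (\<lambda>k l. \<Sum>i\<in>I. T (i, k) (i, l))"

definition partial_trace_snd :: "'j set \<Rightarrow> ('i \<times> 'j) cmat \<Rightarrow> 'i cmat" where
  "partial_trace_snd J T = (\<lambda>k l. \<Sum>j\<in>J. T (k, j) (l, j))"

definition Omega :: "'a set \<Rightarrow> ('a \<times> 'a) cmat" where
  "Omega A = (\<lambda>p q. \<Sum>a\<in>A. \<Sum>b\<in>A. tensor (matrix_unit a b) (matrix_unit a b) p q)"


section \<open>Channels\<close>

definition linear_map_on :: "'i cmat set \<Rightarrow> ('i cmat \<Rightarrow> 'j cmat) \<Rightarrow> bool" where
  "linear_map_on \<S> \<Phi> \<longleftrightarrow>
     (\<forall>S\<in>\<S>. \<forall>T\<in>\<S>. \<Phi> (\<lambda>i j. S i j + T i j) = (\<lambda>k l. \<Phi> S k l + \<Phi> T k l)) \<and>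
     (\<forall>c. \<forall>S\<in>\<S>. \<Phi> (\<lambda>i j. c * S i j) = (\<lambda>k l. c * \<Phi> S k l))"

text \<open>\<open>ampliate \<Phi>\<close> is \<open>id \<otimes> \<Phi>\<close>, acting blockwise on block matrices.\<close>

definition ampliate :: "('i cmat \<Rightarrow> 'j cmat) \<Rightarrow> (nat \<times> 'i) cmat \<Rightarrow> (nat \<times> 'j) cmat" where
  "ampliate \<Phi> T = (\<lambda>p q. \<Phi> (\<lambda>i j. T (fst p, i) (fst q, j)) (snd p) (snd q))"

text \<open>
  Here \<open>\<S>\<close> is an operator system in \<open>op_algebra I\<close>; \<open>\<Phi>\<close> is completely positive if \<open>id \<otimes> \<Phi>\<close>
  maps positive elements of \<open>M\<^sub>n \<otimes> \<S>\<close> to positive elements of \<open>M\<^sub>n \<otimes> op_algebra J\<close> for all \<open>n\<close>.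
\<close>

definition completely_positive_on ::
  "'i set \<Rightarrow> 'j set \<Rightarrow> 'i cmat set \<Rightarrow> ('i cmat \<Rightarrow> 'j cmat) \<Rightarrow> bool" where
  "completely_positive_on I J \<S> \<Phi> \<longleftrightarrow>
     (\<forall>n T. op_positive ({..<n} \<times> I) T \<and>
            (\<forall>k<n. \<forall>l<n. (\<lambda>i j. T (k, i) (l, j)) \<in> \<S>) \<longrightarrow>
            op_positive ({..<n} \<times> J) (ampliate \<Phi> T))"

definition channel_on ::
  "'i set \<Rightarrow> 'j set \<Rightarrow> 'i cmat set \<Rightarrow> ('i cmat \<Rightarrow> 'j cmat) \<Rightarrow> bool" where
  "channel_on I J \<S> \<Phi> \<longleftrightarrow>
     \<Phi> ` \<S> \<subseteq> op_algebra J \<and> linear_map_on \<S> \<Phi> \<and> completely_positive_on I J \<S> \<Phi> \<and>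
     (\<forall>T\<in>\<S>. op_trace J (\<Phi> T) = op_trace I T)"


section \<open>CQNS correlations\<close>

definition cq_output :: "(('x \<times> 'x) cmat \<Rightarrow> ('a \<times> 'a) cmat) \<Rightarrow> 'x \<Rightarrow> 'x \<Rightarrow> ('a \<times> 'a) cmat" where
  "cq_output \<E> x y = \<E> (tensor (matrix_unit x x) (matrix_unit y y))"

definition cqns_correlation ::
  "'x set \<Rightarrow> 'a set \<Rightarrow> (('x \<times> 'x) cmat \<Rightarrow> ('a \<times> 'a) cmat) \<Rightarrow> bool" where
  "cqns_correlation X A \<E> \<longleftrightarrow>
     channel_on (X \<times> X) (A \<times> A) (diag_algebra (X \<times> X)) \<E> \<and>
     (\<forall>x\<in>X. \<forall>x'\<in>X. \<forall>y\<in>X.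
        partial_trace_fst A (cq_output \<E> x y) = partial_trace_fst A (cq_output \<E> x' y)) \<and>
     (\<forall>x\<in>X. \<forall>y\<in>X. \<forall>y'\<in>X.
        partial_trace_snd A (cq_output \<E> x y) = partial_trace_snd A (cq_output \<E> x y'))"


section \<open>Unital C*-algebras\<close>

definition complex_ring :: "complex ring" where
  "complex_ring = \<lparr>carrier = UNIV, monoid.mult = (*), one = 1, zero = 0, add = (+)\<rparr>"

record 'u cstar_struct = "(complex, 'u) module" +
  adj :: "'u \<Rightarrow> 'u"
  alg_norm :: "'u \<Rightarrow> real"

text \<open>The locale \<open>algebra\<close> of the library cannot be used here: it requires commutativity.\<close>

locale unital_cstar_algebra = module complex_ring \<A> + ring \<A>
  for \<A> :: "'u cstar_struct" (structure) +
  assumes smult_mult_left: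
      "\<lbrakk>x \<in> carrier \<A>; y \<in> carrier \<A>\<rbrakk> \<Longrightarrow> (c \<odot> x) \<otimes> y = c \<odot> (x \<otimes> y)"
    and smult_mult_right:
      "\<lbrakk>x \<in> carrier \<A>; y \<in> carrier \<A>\<rbrakk> \<Longrightarrow> x \<otimes> (c \<odot> y) = c \<odot> (x \<otimes> y)"
    and adj_closed: "x \<in> carrier \<A> \<Longrightarrow> adj \<A> x \<in> carrier \<A>"
    and adj_adj: "x \<in> carrier \<A> \<Longrightarrow> adj \<A> (adj \<A> x) = x"
    and adj_add:
      "\<lbrakk>x \<in> carrier \<A>; y \<in> carrier \<A>\<rbrakk> \<Longrightarrow> adj \<A> (x \<oplus> y) = adj \<A> x \<oplus> adj \<A> y"
    and adj_smult: "x \<in> carrier \<A> \<Longrightarrow> adj \<A> (c \<odot> x) = cnj c \<odot> adj \<A> x"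
    and adj_mult:
      "\<lbrakk>x \<in> carrier \<A>; y \<in> carrier \<A>\<rbrakk> \<Longrightarrow> adj \<A> (x \<otimes> y) = adj \<A> y \<otimes> adj \<A> x"
    and norm_nonneg: "x \<in> carrier \<A> \<Longrightarrow> 0 \<le> alg_norm \<A> x"
    and norm_eq_0_iff: "x \<in> carrier \<A> \<Longrightarrow> alg_norm \<A> x = 0 \<longleftrightarrow> x = \<zero>"
    and norm_triangle:
      "\<lbrakk>x \<in> carrier \<A>; y \<in> carrier \<A>\<rbrakk> \<Longrightarrow> alg_norm \<A> (x \<oplus> y) \<le> alg_norm \<A> x + alg_norm \<A> y"
    and norm_smult: "x \<in> carrier \<A> \<Longrightarrow> alg_norm \<A> (c \<odot> x) = cmod c * alg_norm \<A> x"
    and norm_mult: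
      "\<lbrakk>x \<in> carrier \<A>; y \<in> carrier \<A>\<rbrakk> \<Longrightarrow> alg_norm \<A> (x \<otimes> y) \<le> alg_norm \<A> x * alg_norm \<A> y"
    and cstar_identity:
      "x \<in> carrier \<A> \<Longrightarrow> alg_norm \<A> (adj \<A> x \<otimes> x) = (alg_norm \<A> x)\<^sup>2"
    and complete:
      "\<lbrakk>\<And>n. s n \<in> carrier \<A>;
        \<And>e. e > 0 \<Longrightarrow> \<exists>N. \<forall>m\<ge>N. \<forall>n\<ge>N. alg_norm \<A> (s m \<ominus> s n) < e\<rbrakk>
       \<Longrightarrow> \<exists>x\<in>carrier \<A>. (\<lambda>n. alg_norm \<A> (s n \<ominus> x)) \<longlonglongrightarrow> 0"

definition finite_dim_algebra :: "'u cstar_struct \<Rightarrow> bool" where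
  "finite_dim_algebra \<A> \<longleftrightarrow>
     (\<exists>S. finite S \<and> S \<subseteq> carrier \<A> \<and>
        (\<forall>x\<in>carrier \<A>. \<exists>c. x = (\<Oplus>\<^bsub>\<A>\<^esub> s\<in>S. c s \<odot>\<^bsub>\<A>\<^esub> s)))"

definition tracial_state :: "'u cstar_struct \<Rightarrow> ('u \<Rightarrow> complex) \<Rightarrow> bool" where
  "tracial_state \<A> \<tau> \<longleftrightarrow>
     (\<forall>x\<in>carrier \<A>. \<forall>y\<in>carrier \<A>. \<tau> (x \<oplus>\<^bsub>\<A>\<^esub> y) = \<tau> x + \<tau> y) \<and>
     (\<forall>c. \<forall>x\<in>carrier \<A>. \<tau> (c \<odot>\<^bsub>\<A>\<^esub> x) = c * \<tau> x) \<and>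
     (\<forall>x\<in>carrier \<A>. \<tau> (adj \<A> x \<otimes>\<^bsub>\<A>\<^esub> x) \<in> \<real>\<^sub>\<ge>\<^sub>0) \<and>
     \<tau> \<one>\<^bsub>\<A>\<^esub> = 1 \<and>
     (\<forall>x\<in>carrier \<A>. \<forall>y\<in>carrier \<A>. \<tau> (x \<otimes>\<^bsub>\<A>\<^esub> y) = \<tau> (y \<otimes>\<^bsub>\<A>\<^esub> x))"

text \<open>
  The family \<open>(g\<^sub>a\<^sub>,\<^sub>a\<^sub>')\<close> is the element \<open>\<Sum> e\<^sub>a e\<^sub>a\<^sub>'\<^sup>* \<otimes> g\<^sub>a\<^sub>,\<^sub>a\<^sub>'\<close> of \<open>M\<^sub>A \<otimes> \<A>\<close>; the positive elements of
  this C*-algebra are those of the form \<open>h\<^sup>* h\<close>, and \<open>(h\<^sup>* h)\<^sub>a\<^sub>,\<^sub>a\<^sub>' = \<Sum>\<^sub>b (h\<^sub>b\<^sub>,\<^sub>a)\<^sup>* h\<^sub>b\<^sub>,\<^sub>a\<^sub>'\<close>.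
\<close>

definition positive_matrix_over :: "'u cstar_struct \<Rightarrow> 'a set \<Rightarrow> ('a \<Rightarrow> 'a \<Rightarrow> 'u) \<Rightarrow> bool" where
  "positive_matrix_over \<A> A g \<longleftrightarrow>
     (\<exists>h. (\<forall>b\<in>A. \<forall>a\<in>A. h b a \<in> carrier \<A>) \<and>
          (\<forall>a\<in>A. \<forall>a'\<in>A. g a a' = (\<Oplus>\<^bsub>\<A>\<^esub> b\<in>A. adj \<A> (h b a) \<otimes>\<^bsub>\<A>\<^esub> h b a')))"


section \<open>Tracial correlations\<close>

definition tracial_realisation ::
  "'u cstar_struct \<Rightarrow> ('u \<Rightarrow> complex) \<Rightarrow> 'x set \<Rightarrow> 'a set \<Rightarrow>
   (('x \<times> 'x) cmat \<Rightarrow> ('a \<times> 'a) cmat) \<Rightarrow> bool" where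
  "tracial_realisation \<A> \<tau> X A \<E> \<longleftrightarrow>
     unital_cstar_algebra \<A> \<and> tracial_state \<A> \<tau> \<and>
     (\<exists>g. (\<forall>x\<in>X. positive_matrix_over \<A> A (g x) \<and> (\<Oplus>\<^bsub>\<A>\<^esub> a\<in>A. g x a a) = \<one>\<^bsub>\<A>\<^esub>) \<and>
          (\<forall>x\<in>X. \<forall>y\<in>X. cq_output \<E> x y =
             (\<lambda>p q. \<Sum>a\<in>A. \<Sum>a'\<in>A. \<Sum>b\<in>A. \<Sum>b'\<in>A.
                \<tau> (g x a a' \<otimes>\<^bsub>\<A>\<^esub> g y b' b) * tensor (matrix_unit a a') (matrix_unit b b') p q)))"

text \<open>
  The existential quantifier over C*-algebras is bounded by a type \<open>'u\<close>: the elements of the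
  algebra are drawn from \<open>'u\<close>.  Since one may pass to the separable C*-subalgebra generated by the
  finitely many \<open>g\<^sub>x\<^sub>,\<^sub>a\<^sub>,\<^sub>a\<^sub>'\<close>, nothing is lost once \<open>'u\<close> has at least the cardinality of the continuum.
\<close>

definition tracial_correlation ::
  "'u itself \<Rightarrow> 'x set \<Rightarrow> 'a set \<Rightarrow> (('x \<times> 'x) cmat \<Rightarrow> ('a \<times> 'a) cmat) \<Rightarrow> bool" where
  "tracial_correlation _ X A \<E> \<longleftrightarrow>
     (\<exists>(\<A> :: 'u cstar_struct) \<tau>. tracial_realisation \<A> \<tau> X A \<E>)"

definition quantum_tracial_correlation ::
  "'u itself \<Rightarrow> 'x set \<Rightarrow> 'a set \<Rightarrow> (('x \<times> 'x) cmat \<Rightarrow> ('a \<times> 'a) cmat) \<Rightarrow> bool" where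
  "quantum_tracial_correlation _ X A \<E> \<longleftrightarrow>
     (\<exists>(\<A> :: 'u cstar_struct) \<tau>. finite_dim_algebra \<A> \<and> tracial_realisation \<A> \<tau> X A \<E>)"


section \<open>Quantum colourings of graphs\<close>

text \<open>
  A finite simple graph is a \<open>pair_graph\<close>: a finite loopless symmetric digraph; \<open>x\<close> and \<open>y\<close> are
  adjacent iff \<open>(x, y) \<in> parcs G\<close>.
\<close>

definition proper_correlation ::
  "'x pair_pre_digraph \<Rightarrow> 'a set \<Rightarrow> (('x \<times> 'x) cmat \<Rightarrow> ('a \<times> 'a) cmat) \<Rightarrow> bool" where
  "proper_correlation G A \<E> \<longleftrightarrow>
     (\<forall>x y. (x, y) \<in> parcs G \<longrightarrow> op_pairing (A \<times> A) (cq_output \<E> x y) (Omega A) = 0)"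

definition qc_colouring ::
  "'u itself \<Rightarrow> 'x pair_pre_digraph \<Rightarrow> 'a set \<Rightarrow> (('x \<times> 'x) cmat \<Rightarrow> ('a \<times> 'a) cmat) \<Rightarrow> bool" where
  "qc_colouring U G A \<E> \<longleftrightarrow>
     cqns_correlation (pverts G) A \<E> \<and> proper_correlation G A \<E> \<and>
     tracial_correlation U (pverts G) A \<E>"

definition q_colouring ::
  "'u itself \<Rightarrow> 'x pair_pre_digraph \<Rightarrow> 'a set \<Rightarrow> (('x \<times> 'x) cmat \<Rightarrow> ('a \<times> 'a) cmat) \<Rightarrow> bool" where
  "q_colouring U G A \<E> \<longleftrightarrow>
     cqns_correlation (pverts G) A \<E> \<and> proper_correlation G A \<E> \<and>
     quantum_tracial_correlation U (pverts G) A \<E>"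

text \<open>Only \<open>card A\<close> matters, so the finite colour sets \<open>A\<close> are taken among the sets of naturals.\<close>

definition xi_qc :: "'u itself \<Rightarrow> 'x pair_pre_digraph \<Rightarrow> nat" where
  "xi_qc U G = (LEAST n. \<exists>(A :: nat set) \<E>. finite A \<and> card A = n \<and> qc_colouring U G A \<E>)"

definition xi_q :: "'u itself \<Rightarrow> 'x pair_pre_digraph \<Rightarrow> nat" where
  "xi_q U G = (LEAST n. \<exists>(A :: nat set) \<E>. finite A \<and> card A = n \<and> q_colouring U G A \<E>)"


section \<open>The Lovasz number\<close>

text \<open>
  Vectors of \<open>\<real>\<^sup>n\<close> are functions on \<open>nat\<close> of which only the values below \<open>n\<close> are used.
  Convention: non-adjacent distinct vertices get orthogonal vectors, so the complete graphs have
  Lovasz number 1.  A handle \<open>c\<close> orthogonal to some \<open>u\<^sub>x\<close> has value \<open>\<infinity>\<close> and is therefore left out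
  of the minimum (\<open>1 / 0\<close> would be \<open>0\<close>).
\<close>

definition dot_prod :: "nat \<Rightarrow> (nat \<Rightarrow> real) \<Rightarrow> (nat \<Rightarrow> real) \<Rightarrow> real" where
  "dot_prod n u v = (\<Sum>k<n. u k * v k)"

definition orthonormal_representation ::
  "'x pair_pre_digraph \<Rightarrow> nat \<Rightarrow> ('x \<Rightarrow> nat \<Rightarrow> real) \<Rightarrow> bool" where
  "orthonormal_representation G n u \<longleftrightarrow>
     (\<forall>x\<in>pverts G. dot_prod n (u x) (u x) = 1) \<and>
     (\<forall>x\<in>pverts G. \<forall>y\<in>pverts G. x \<noteq> y \<and> (x, y) \<notin> parcs G \<longrightarrow> dot_prod n (u x) (u y) = 0)"

definition lovasz_number :: "'x pair_pre_digraph \<Rightarrow> real" where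
  "lovasz_number G =
     Inf {Max ((\<lambda>x. 1 / (dot_prod n c (u x))\<^sup>2) ` pverts G) | n u c.
            orthonormal_representation G n u \<and> dot_prod n c c = 1 \<and>
            (\<forall>x\<in>pverts G. dot_prod n c (u x) \<noteq> 0)}"

end

theory Submission
  imports Defs
begin

text \<open>
  Lower bound.  Let \<open>g\<^sub>x\<close> realise a colouring with \<open>|A|\<close> colours and let \<open>u\<close>, \<open>c\<close> be an orthonormal
  representation of \<open>G\<close> with a handle.  In the GNS space of \<open>Tr \<otimes> \<tau>\<close> tensored with \<open>\<real>\<^sup>n\<close> the vectors
  \<open>g\<^sub>x \<otimes> u\<^sub>x\<close> are pairwise orthogonal: properness settles adjacent pairs, the representation the other
  ones.  Since \<open>g\<^sub>x\<close> is positive with partial trace \<open>1\<close>, it satisfies \<open>g\<^sub>x \<le> |A| 1\<close>, so that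
  \<open>\<parallel>g\<^sub>x\<parallel>\<^sup>2 \<le> |A|\<close>, while \<open>\<langle>1, g\<^sub>x\<rangle> = 1\<close> and \<open>\<parallel>1\<parallel>\<^sup>2 = |A|\<close>.  Bessel's inequality for \<open>1 \<otimes> c\<close> thus gives
  \<open>\<Sum>\<^sub>x \<langle>c, u\<^sub>x\<rangle>\<^sup>2 \<le> |A|\<^sup>2\<close>.

  Upper bound for complete graphs.  With the \<open>d\<^sup>2\<close> trace-orthogonal Heisenberg-Weyl unitaries \<open>U\<^sub>x\<close> of
  \<open>M\<^sub>d\<close>, the matrices \<open>g\<^sub>x\<^sub>,\<^sub>a\<^sub>,\<^sub>a\<^sub>' = U\<^sub>x e\<^sub>a e\<^sub>a\<^sub>'\<^sup>* U\<^sub>x\<^sup>*\<close> colour \<open>d\<^sup>2\<close> pairwise adjacent vertices by \<open>d\<close> colours.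
\<close>

section \<open>Traces of positive matrices over a C*-algebra\<close>

lemma sum_swap_pairs:
  "(\<Sum>a\<in>A. \<Sum>b\<in>B. \<Sum>c\<in>C. \<Sum>d\<in>D. f a b c d) = (\<Sum>c\<in>C. \<Sum>d\<in>D. \<Sum>a\<in>A. \<Sum>b\<in>B. f a b c d)"
  apply (subst (2) sum.swap)
  apply (subst sum.swap)
  apply (subst (3) sum.swap)
  apply (subst (2) sum.swap)
  by (rule refl)

locale tracial_cstar_algebra = unital_cstar_algebra +
  fixes \<tau> :: "'a \<Rightarrow> complex"
  assumes tracial: "tracial_state \<A> \<tau>"
begin

section \<open>Linear calculus of the trace and the adjoint\<close>

lemma trace_add: "\<lbrakk>x \<in> carrier \<A>; y \<in> carrier \<A>\<rbrakk> \<Longrightarrow> \<tau> (x \<oplus> y) = \<tau> x + \<tau> y"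
  and trace_smult: "x \<in> carrier \<A> \<Longrightarrow> \<tau> (c \<odot> x) = c * \<tau> x"
  and trace_positive: "x \<in> carrier \<A> \<Longrightarrow> \<tau> (adj \<A> x \<otimes> x) \<in> \<real>\<^sub>\<ge>\<^sub>0"
  and trace_one: "\<tau> \<one> = 1"
  and trace_commute: "\<lbrakk>x \<in> carrier \<A>; y \<in> carrier \<A>\<rbrakk> \<Longrightarrow> \<tau> (x \<otimes> y) = \<tau> (y \<otimes> x)"
  using tracial unfolding tracial_state_def by auto

lemma smult_in_carrier: "x \<in> carrier \<A> \<Longrightarrow> c \<odot> x \<in> carrier \<A>"
  using smult_closed by (simp add: complex_ring_def)

lemma trace_zero: "\<tau> \<zero> = 0"
  using trace_add[of \<zero> \<zero>] by simp

lemma adj_zero: "adj \<A> \<zero> = \<zero>"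
proof -
  have "adj \<A> \<zero> \<oplus> adj \<A> \<zero> = adj \<A> \<zero>"
    using adj_add[of \<zero> \<zero>] by simp
  then show ?thesis
    using adj_closed[of \<zero>] by (metis add.l_cancel_one zero_closed)
qed

lemma adj_one: "adj \<A> \<one> = \<one>"
  by (metis adj_adj adj_closed adj_mult one_closed r_one)

lemma trace_finsum:
  "\<lbrakk>finite I; f \<in> I \<rightarrow> carrier \<A>\<rbrakk> \<Longrightarrow> \<tau> (\<Oplus>i\<in>I. f i) = (\<Sum>i\<in>I. \<tau> (f i))"
  by (induction rule: finite_induct) (auto simp: trace_zero trace_add Pi_iff)

lemma adj_finsum:
  "\<lbrakk>finite I; f \<in> I \<rightarrow> carrier \<A>\<rbrakk> \<Longrightarrow> adj \<A> (\<Oplus>i\<in>I. f i) = (\<Oplus>i\<in>I. adj \<A> (f i))"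
  by (induction rule: finite_induct) (auto simp: adj_zero adj_add adj_closed Pi_iff)

lemma trace_finsum_mult_finsum:
  assumes "finite I" "finite J" "f \<in> I \<rightarrow> carrier \<A>" "g \<in> J \<rightarrow> carrier \<A>"
  shows "\<tau> ((\<Oplus>i\<in>I. f i) \<otimes> (\<Oplus>j\<in>J. g j)) = (\<Sum>i\<in>I. \<Sum>j\<in>J. \<tau> (f i \<otimes> g j))"
proof -
  have "(\<Oplus>i\<in>I. f i) \<otimes> (\<Oplus>j\<in>J. g j) = (\<Oplus>i\<in>I. f i \<otimes> (\<Oplus>j\<in>J. g j))"
    using assms by (intro finsum_ldistr) auto
  also have "\<tau> \<dots> = (\<Sum>i\<in>I. \<tau> (f i \<otimes> (\<Oplus>j\<in>J. g j)))"
    using assms by (intro trace_finsum) auto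
  also have "\<dots> = (\<Sum>i\<in>I. \<Sum>j\<in>J. \<tau> (f i \<otimes> g j))"
  proof (rule sum.cong[OF refl])
    fix i assume "i \<in> I"
    then have fi: "f i \<in> carrier \<A>" using assms by auto
    then have "f i \<otimes> (\<Oplus>j\<in>J. g j) = (\<Oplus>j\<in>J. f i \<otimes> g j)"
      using assms by (intro finsum_rdistr) auto
    then show "\<tau> (f i \<otimes> (\<Oplus>j\<in>J. g j)) = (\<Sum>j\<in>J. \<tau> (f i \<otimes> g j))"
      using fi assms trace_finsum[of J "\<lambda>j. f i \<otimes> g j"] by auto
  qed
  finally show ?thesis .
qed

text \<open>The double sum is \<open>\<tau>\<close> at x^* x for the combination x of the
  \<open>w i\<close> with coefficients \<open>c i\<close>, that is, the squared GNS seminorm of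
  x.\<close>

lemma gram_positive:
  assumes "finite I" "w \<in> I \<rightarrow> carrier \<A>"
  shows "(\<Sum>i\<in>I. \<Sum>j\<in>I. cnj (c i) * c j * \<tau> (adj \<A> (w i) \<otimes> w j)) \<in> \<real>\<^sub>\<ge>\<^sub>0"
proof -
  let ?x = "\<Oplus>i\<in>I. c i \<odot> w i"
  have w: "i \<in> I \<Longrightarrow> w i \<in> carrier \<A>" for i using assms by auto
  have "\<tau> (adj \<A> ?x \<otimes> ?x) = \<tau> ((\<Oplus>i\<in>I. adj \<A> (c i \<odot> w i)) \<otimes> ?x)"
    using assms w by (subst adj_finsum) (auto intro: smult_in_carrier)
  also have "\<dots> = (\<Sum>i\<in>I. \<Sum>j\<in>I. \<tau> (adj \<A> (c i \<odot> w i) \<otimes> (c j \<odot> w j)))"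
    using assms w by (intro trace_finsum_mult_finsum) (auto intro: smult_in_carrier adj_closed)
  also have "\<dots> = (\<Sum>i\<in>I. \<Sum>j\<in>I. cnj (c i) * c j * \<tau> (adj \<A> (w i) \<otimes> w j))"
    using w by (intro sum.cong refl)
      (simp add: adj_smult smult_mult_left smult_mult_right smult_in_carrier adj_closed trace_smult)
  finally show ?thesis
    using trace_positive[of ?x] w by (auto intro: smult_in_carrier finsum_closed)
qed

text \<open>Expansion of the squared GNS seminorm of x - y. The index type \<open>bool\<close>
  carries the two vectors, with coefficients 1 and -1.\<close>

lemma trace_cross_le:
  assumes "x \<in> carrier \<A>" "y \<in> carrier \<A>"
  shows "Re (\<tau> (adj \<A> x \<otimes> y)) + Re (\<tau> (adj \<A> y \<otimes> x))
       \<le> Re (\<tau> (adj \<A> x \<otimes> x)) + Re (\<tau> (adj \<A> y \<otimes> y))"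
  using gram_positive[of UNIV "\<lambda>b. if b then x else y" "\<lambda>b. if b then 1 else - 1"] assms
  by (auto simp: UNIV_bool complex_nonneg_Reals_iff)

text \<open>In the GNS seminorm, |z_1 + ... + z_k|^2 is at most k (|z_1|^2 + ... + |z_k|^2): once
  the double sum is symmetrised, \<open>trace_cross_le\<close> bounds it term by term.\<close>

lemma trace_sum_le:
  assumes "finite I" "z \<in> I \<rightarrow> carrier \<A>"
  shows "(\<Sum>i\<in>I. \<Sum>j\<in>I. Re (\<tau> (adj \<A> (z i) \<otimes> z j)))
       \<le> card I * (\<Sum>i\<in>I. Re (\<tau> (adj \<A> (z i) \<otimes> z i)))"
proof -
  let ?r = "\<lambda>i j. Re (\<tau> (adj \<A> (z i) \<otimes> z j))"
  have "2 * (\<Sum>i\<in>I. \<Sum>j\<in>I. ?r i j) = (\<Sum>i\<in>I. \<Sum>j\<in>I. ?r i j + ?r j i)"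
    using sum.swap[of "\<lambda>i j. ?r i j" I I] by (simp add: sum.distrib)
  also have "\<dots> \<le> (\<Sum>i\<in>I. \<Sum>j\<in>I. ?r i i + ?r j j)"
    using assms by (intro sum_mono trace_cross_le) auto
  also have "\<dots> = 2 * (card I * (\<Sum>i\<in>I. ?r i i))"
    by (simp add: sum.distrib sum_distrib_left mult.commute)
  finally show ?thesis by simp
qed

section \<open>Positive matrices with entries in the algebra\<close>

lemma positive_matrix_closed:
  assumes "finite B" "positive_matrix_over \<A> B g" "a \<in> B" "a' \<in> B"
  shows "g a a' \<in> carrier \<A>"
  using assms unfolding positive_matrix_over_def
  by (force intro!: finsum_closed m_closed adj_closed)

lemma positive_matrix_adj:
  assumes "finite B" "positive_matrix_over \<A> B g" "a \<in> B" "a' \<in> B"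
  shows "adj \<A> (g a a') = g a' a"
proof -
  obtain h where h: "\<And>b a. \<lbrakk>b \<in> B; a \<in> B\<rbrakk> \<Longrightarrow> h b a \<in> carrier \<A>"
    and g: "\<And>a a'. \<lbrakk>a \<in> B; a' \<in> B\<rbrakk> \<Longrightarrow> g a a' = (\<Oplus>b\<in>B. adj \<A> (h b a) \<otimes> h b a')"
    using assms(2) unfolding positive_matrix_over_def by blast
  have "adj \<A> (g a a') = (\<Oplus>b\<in>B. adj \<A> (adj \<A> (h b a) \<otimes> h b a'))"
    using assms h by (simp add: g adj_finsum adj_closed Pi_iff)
  also have "\<dots> = (\<Oplus>b\<in>B. adj \<A> (h b a') \<otimes> h b a)"
    using assms h by (intro add.finprod_cong') (auto simp: adj_mult adj_adj adj_closed)
  finally show ?thesis using assms by (simp add: g)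
qed

text \<open>Reflects the operator inequality \<open>g \<le> |B| (1 \<otimes> Tr g)\<close> for positive \<open>g\<close>.\<close>

lemma positive_matrix_square_trace_le:
  assumes fin: "finite B" and pos: "positive_matrix_over \<A> B g"
    and unit: "(\<Oplus>a\<in>B. g a a) = \<one>"
  shows "Re (\<Sum>a\<in>B. \<Sum>a'\<in>B. \<tau> (g a a' \<otimes> g a' a)) \<le> card B"
proof -
  obtain h where h: "\<And>b a. \<lbrakk>b \<in> B; a \<in> B\<rbrakk> \<Longrightarrow> h b a \<in> carrier \<A>"
    and g: "\<And>a a'. \<lbrakk>a \<in> B; a' \<in> B\<rbrakk> \<Longrightarrow> g a a' = (\<Oplus>b\<in>B. adj \<A> (h b a) \<otimes> h b a')"
    using pos unfolding positive_matrix_over_def by blast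
  note [simp] = h adj_closed
  \<comment> \<open>By cyclicity, each summand of \<open>\<tau> (g a a' \<otimes> g a' a)\<close> is
    a GNS inner product of \<open>z b' b a' a'\<close> and \<open>z b' b a a\<close>. Only vectors
    whose last two indices agree occur, so for fixed \<open>b\<close>, \<open>b'\<close> they form a
    family indexed by a single colour.\<close>
  define z where "z b b' a a' = h b a \<otimes> adj \<A> (h b' a')" for b b' a a'
  have z[simp]: "\<lbrakk>b \<in> B; b' \<in> B; a \<in> B; a' \<in> B\<rbrakk> \<Longrightarrow> z b b' a a' \<in> carrier \<A>" for b b' a a'
    by (simp add: z_def)
  \<comment> \<open>The squared GNS seminorm of \<open>z\<close>. By \<open>q_eq\<close>, its sum
    over all four indices is \<open>\<tau>\<close> of the squared diagonal sum of \<open>g\<close>,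
    which is 1.\<close>
  define q where "q b b' a a' = Re (\<tau> (adj \<A> (z b b' a a') \<otimes> z b b' a a'))" for b b' a a'
  have q_eq: "\<tau> (adj \<A> (z b b' a a') \<otimes> z b b' a a') =
      \<tau> ((adj \<A> (h b a) \<otimes> h b a) \<otimes> (adj \<A> (h b' a') \<otimes> h b' a'))"
    if "b \<in> B" "b' \<in> B" "a \<in> B" "a' \<in> B" for b b' a a'
  proof -
    have "adj \<A> (z b b' a a') \<otimes> z b b' a a' =
        h b' a' \<otimes> ((adj \<A> (h b a) \<otimes> h b a) \<otimes> adj \<A> (h b' a'))"
      using that by (simp add: z_def adj_mult adj_adj m_assoc)
    also have "\<tau> \<dots> = \<tau> (((adj \<A> (h b a) \<otimes> h b a) \<otimes> adj \<A> (h b' a')) \<otimes> h b' a')"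
      using that by (intro trace_commute) simp_all
    finally show ?thesis using that by (simp add: m_assoc)
  qed
  have prod: "\<tau> (g a a' \<otimes> g c c') =
      (\<Sum>b\<in>B. \<Sum>b'\<in>B. \<tau> ((adj \<A> (h b a) \<otimes> h b a') \<otimes> (adj \<A> (h b' c) \<otimes> h b' c')))"
    if "a \<in> B" "a' \<in> B" "c \<in> B" "c' \<in> B" for a a' c c'
    using that fin by (simp add: g trace_finsum_mult_finsum)
  have "\<tau> ((adj \<A> (h b a) \<otimes> h b a') \<otimes> (adj \<A> (h b' a') \<otimes> h b' a)) =
      \<tau> (adj \<A> (z b' b a' a') \<otimes> z b' b a a)"
    if "b \<in> B" "b' \<in> B" "a \<in> B" "a' \<in> B" for b b' a a'
  proof -
    have "adj \<A> (z b' b a' a') \<otimes> z b' b a a =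
        (h b a' \<otimes> (adj \<A> (h b' a') \<otimes> h b' a)) \<otimes> adj \<A> (h b a)"
      using that by (simp add: z_def adj_mult adj_adj m_assoc)
    also have "\<tau> \<dots> = \<tau> (adj \<A> (h b a) \<otimes> (h b a' \<otimes> (adj \<A> (h b' a') \<otimes> h b' a)))"
      using that by (intro trace_commute) simp_all
    finally show ?thesis using that by (simp add: m_assoc)
  qed
  then have "Re (\<Sum>a\<in>B. \<Sum>a'\<in>B. \<tau> (g a a' \<otimes> g a' a)) =
      (\<Sum>a\<in>B. \<Sum>a'\<in>B. \<Sum>b\<in>B. \<Sum>b'\<in>B. Re (\<tau> (adj \<A> (z b' b a' a') \<otimes> z b' b a a)))"
    by (simp add: prod)
  also have "\<dots> = (\<Sum>b\<in>B. \<Sum>b'\<in>B. \<Sum>a\<in>B. \<Sum>a'\<in>B. Re (\<tau> (adj \<A> (z b' b a' a') \<otimes> z b' b a a)))"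
    by (rule sum_swap_pairs)
  also have "\<dots> = (\<Sum>b\<in>B. \<Sum>b'\<in>B. \<Sum>a'\<in>B. \<Sum>a\<in>B. Re (\<tau> (adj \<A> (z b' b a' a') \<otimes> z b' b a a)))"
    by (intro sum.cong refl sum.swap)
  \<comment> \<open>Here \<open>trace_sum_le\<close> is applied to the family
    \<open>\<lambda>a. z b' b a a\<close>, which produces the factor \<open>card B\<close>.\<close>
  also have "\<dots> \<le> (\<Sum>b\<in>B. \<Sum>b'\<in>B. card B * (\<Sum>a\<in>B. q b' b a a))"
    unfolding q_def using fin by (intro sum_mono trace_sum_le) auto
  \<comment> \<open>The nonnegative terms with \<open>a \<noteq> a'\<close> are added, completing
    the sum of \<open>q\<close> over all four indices.\<close>
  also have "\<dots> \<le> (\<Sum>b\<in>B. \<Sum>b'\<in>B. card B * (\<Sum>a\<in>B. \<Sum>a'\<in>B. q b' b a a'))"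
  proof (intro sum_mono mult_left_mono)
    fix b b' a assume "b \<in> B" "b' \<in> B" "a \<in> B"
    then have "0 \<le> q b' b a a'" if "a' \<in> B" for a'
      using trace_positive[of "z b' b a a'"] that by (simp add: q_def complex_nonneg_Reals_iff)
    then show "q b' b a a \<le> (\<Sum>a'\<in>B. q b' b a a')"
      using \<open>a \<in> B\<close> fin by (intro member_le_sum) auto
  qed simp
  also have "\<dots> = card B * (\<Sum>a\<in>B. \<Sum>a'\<in>B. \<Sum>b\<in>B. \<Sum>b'\<in>B. q b b' a a')"
    unfolding sum_distrib_left[symmetric]
    by (subst sum_swap_pairs) (intro arg_cong[of _ _ "(*) _"] sum.cong refl sum.swap)
  also have "(\<Sum>a\<in>B. \<Sum>a'\<in>B. \<Sum>b\<in>B. \<Sum>b'\<in>B. q b b' a a') =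
      Re (\<Sum>a\<in>B. \<Sum>a'\<in>B. \<tau> (g a a \<otimes> g a' a'))"
    by (simp add: prod q_def q_eq)
  also have "(\<Sum>a\<in>B. \<Sum>a'\<in>B. \<tau> (g a a \<otimes> g a' a')) = 1"
    using trace_finsum_mult_finsum[of B B "\<lambda>a. g a a" "\<lambda>a. g a a"]
      positive_matrix_closed[OF fin pos] fin unit
    by (simp add: Pi_iff trace_one)
  finally show ?thesis by simp
qed

text \<open>The entrywise product of two Gram matrices is the Gram matrix of the tensor products of
  the v_i with the w_i, so its entries sum to a squared norm. For each coordinate \<open>k\<close>
  and \<open>b\<close> this is an instance of \<open>gram_positive\<close>.\<close>

lemma gram_dot_prod_nonneg:
  assumes "finite I" "finite B" "\<And>i b. \<lbrakk>i \<in> I; b \<in> B\<rbrakk> \<Longrightarrow> w i b \<in> carrier \<A>"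
  shows "0 \<le> (\<Sum>i\<in>I. \<Sum>j\<in>I. dot_prod n (v i) (v j) *
                 Re (\<Sum>b\<in>B. \<tau> (adj \<A> (w i b) \<otimes> w j b)))"
proof -
  have "0 \<le> (\<Sum>k<n. \<Sum>b\<in>B. Re (\<Sum>i\<in>I. \<Sum>j\<in>I. cnj (complex_of_real (v i k)) * v j k *
              \<tau> (adj \<A> (w i b) \<otimes> w j b)))"
    using assms gram_positive[of I "\<lambda>i. w i _" "\<lambda>i. complex_of_real (v i _)"]
    by (intro sum_nonneg) (auto simp: complex_nonneg_Reals_iff)
  also have "\<dots> = (\<Sum>k<n. \<Sum>b\<in>B. \<Sum>i\<in>I. \<Sum>j\<in>I. v i k * v j k * Re (\<tau> (adj \<A> (w i b) \<otimes> w j b)))"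
    by simp
  also have "\<dots> = (\<Sum>i\<in>I. \<Sum>j\<in>I. \<Sum>k<n. \<Sum>b\<in>B. v i k * v j k * Re (\<tau> (adj \<A> (w i b) \<otimes> w j b)))"
    by (rule sum_swap_pairs)
  also have "\<dots> = (\<Sum>i\<in>I. \<Sum>j\<in>I. dot_prod n (v i) (v j) *
                 Re (\<Sum>b\<in>B. \<tau> (adj \<A> (w i b) \<otimes> w j b)))"
    by (simp add: dot_prod_def sum_product)
  finally show ?thesis .
qed

text \<open>Expands the nonnegative squared norm of 1 \<otimes> c minus the sum of all t_x (g_x
  \<otimes> u_x). With m = \<open>card B\<close>, the first vector contributes m, the cross terms -2
  m t_x^2, and the remaining terms at most m t_x^2.\<close>

lemma bessel_orthonormal_representation:
  assumes fin: "finite X" "finite B"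
    and pos: "\<And>x. x \<in> X \<Longrightarrow> positive_matrix_over \<A> B (g x)"
    and unit: "\<And>x. x \<in> X \<Longrightarrow> (\<Oplus>a\<in>B. g x a a) = \<one>"
    and c: "dot_prod n c c = 1"
    and u: "\<And>x. x \<in> X \<Longrightarrow> dot_prod n (u x) (u x) = 1"
    and orth: "\<And>x y. \<lbrakk>x \<in> X; y \<in> X; x \<noteq> y\<rbrakk> \<Longrightarrow>
      dot_prod n (u x) (u y) = 0 \<or> (\<Sum>a\<in>B. \<Sum>a'\<in>B. \<tau> (g x a a' \<otimes> g y a' a)) = 0"
  shows "(\<Sum>x\<in>X. (dot_prod n c (u x))\<^sup>2) \<le> (card B)\<^sup>2"
proof (cases "X = {}")
  case False
  note g[simp] = positive_matrix_closed[OF fin(2) pos]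
  define m where "m = real (card B)"
  \<comment> \<open>An empty \<open>B\<close> would turn the unit into an empty sum, hence into
    zero, against \<open>trace_one\<close>.\<close>
  have "B \<noteq> {}"
    using False unit trace_one trace_zero by fastforce
  then have m: "m > 0" using fin by (simp add: m_def card_gt_0_iff)
  \<comment> \<open>The projection coefficient would be <c, u_x> / |g_x|^2. Replacing |g_x|^2 by its
    upper bound \<open>m\<close> still gives the estimate and avoids any lower bound on
    |g_x|.\<close>
  define t where "t x = dot_prod n c (u x) / m" for x
  define v where "v i k = (case i of None \<Rightarrow> c k | Some x \<Rightarrow> - t x * u x k)" for i k
  define w where "w i = (case i of None \<Rightarrow> \<lambda>(a, a'). if a = a' then \<one> else \<zero>
                             | Some x \<Rightarrow> \<lambda>(a, a'). g x a a')" for i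
  define G where "G i j = Re (\<Sum>b\<in>B\<times>B. \<tau> (adj \<A> (w i b) \<otimes> w j b))" for i j
  have G_sum: "G i j = Re (\<Sum>a\<in>B. \<Sum>a'\<in>B. \<tau> (adj \<A> (w i (a, a')) \<otimes> w j (a, a')))" for i j
    by (simp add: G_def sum.cartesian_product)
  have w_closed: "w i b \<in> carrier \<A>" if "i \<in> insert None (Some ` X)" "b \<in> B \<times> B" for i b
    using that by (auto simp: w_def)
  have tr: "(\<Sum>a\<in>B. \<tau> (g x a a)) = 1" if "x \<in> X" for x
    using trace_finsum[of B "\<lambda>a. g x a a"] that fin unit by (simp add: Pi_iff trace_one)
  have N: "G None None = m"
  proof -
    have "\<tau> (adj \<A> (w None (a, a')) \<otimes> w None (a, a')) = (if a = a' then 1 else 0)" for a a'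
      by (simp add: w_def adj_one trace_zero trace_one adj_zero)
    then show ?thesis using fin by (simp add: G_sum m_def)
  qed
  have NS: "G None (Some x) = 1" if "x \<in> X" for x
  proof -
    have "\<tau> (adj \<A> (w None (a, a')) \<otimes> w (Some x) (a, a')) = (if a = a' then \<tau> (g x a a) else 0)"
      if "a \<in> B" "a' \<in> B" for a a'
      using that \<open>x \<in> X\<close> by (simp add: w_def adj_one trace_zero adj_zero)
    then show ?thesis using fin tr[OF that] by (simp add: G_sum)
  qed
  have SN: "G (Some x) None = 1" if "x \<in> X" for x
  proof -
    have "\<tau> (adj \<A> (w (Some x) (a, a')) \<otimes> w None (a, a')) = (if a = a' then \<tau> (g x a a) else 0)"
      if "a \<in> B" "a' \<in> B" for a a'
      using that \<open>x \<in> X\<close> positive_matrix_adj[OF fin(2) pos]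
      by (simp add: w_def adj_closed trace_zero)
    then show ?thesis using fin tr[OF that] by (simp add: G_sum)
  qed
  have SS: "G (Some x) (Some y) = Re (\<Sum>a\<in>B. \<Sum>a'\<in>B. \<tau> (g x a a' \<otimes> g y a' a))"
    if "x \<in> X" "y \<in> X" for x y
  proof -
    have "(\<Sum>a\<in>B. \<Sum>a'\<in>B. \<tau> (adj \<A> (w (Some x) (a, a')) \<otimes> w (Some y) (a, a')))
        = (\<Sum>a\<in>B. \<Sum>a'\<in>B. \<tau> (g x a' a \<otimes> g y a a'))"
      using that positive_matrix_adj[OF fin(2) pos] by (simp add: w_def)
    also have "\<dots> = (\<Sum>a\<in>B. \<Sum>a'\<in>B. \<tau> (g x a a' \<otimes> g y a' a))"
      by (rule sum.swap)
    finally show ?thesis by (simp add: G_sum)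
  qed
  have dN: "dot_prod n (v None) (v None) = 1"
    using c by (simp add: v_def dot_prod_def)
  have dNS: "dot_prod n (v None) (v (Some x)) = - m * (t x)\<^sup>2"
    "dot_prod n (v (Some x)) (v None) = - m * (t x)\<^sup>2" for x
  proof -
    have "dot_prod n (v None) (v (Some x)) = - t x * dot_prod n c (u x)"
      by (simp add: v_def dot_prod_def sum_distrib_left sum_negf algebra_simps)
    also have "\<dots> = - m * (t x)\<^sup>2" using m by (simp add: t_def power2_eq_square)
    finally show "dot_prod n (v None) (v (Some x)) = - m * (t x)\<^sup>2" .
    then show "dot_prod n (v (Some x)) (v None) = - m * (t x)\<^sup>2"
      by (simp add: dot_prod_def mult.commute)
  qed
  have dSS: "dot_prod n (v (Some x)) (v (Some y)) = t x * t y * dot_prod n (u x) (u y)" for x y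
    by (simp add: v_def dot_prod_def sum_distrib_left algebra_simps)
  have diag: "(\<Sum>y\<in>X. dot_prod n (v (Some x)) (v (Some y)) * G (Some x) (Some y)) \<le> m * (t x)\<^sup>2"
    if x: "x \<in> X" for x
  proof -
    \<comment> \<open>Orthogonality in one of the two tensor factors leaves only the term
      \<open>y = x\<close>.\<close>
    have "dot_prod n (v (Some x)) (v (Some y)) * G (Some x) (Some y) =
        (if y = x then (t x)\<^sup>2 * G (Some x) (Some x) else 0)" if "y \<in> X" for y
      using orth[OF x that] x that by (auto simp: dSS SS u power2_eq_square simp del: Re_sum)
    then have "(\<Sum>y\<in>X. dot_prod n (v (Some x)) (v (Some y)) * G (Some x) (Some y)) =
        (t x)\<^sup>2 * G (Some x) (Some x)"
      using fin x by simp
    also have "\<dots> \<le> (t x)\<^sup>2 * m"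
      using positive_matrix_square_trace_le[OF fin(2) pos[OF x] unit[OF x]]
      by (intro mult_left_mono) (simp_all add: SS x m_def)
    finally show ?thesis by (simp add: mult.commute)
  qed
  have "0 \<le> (\<Sum>i\<in>insert None (Some ` X). \<Sum>j\<in>insert None (Some ` X). dot_prod n (v i) (v j) * G i j)"
    unfolding G_def using fin w_closed by (intro gram_dot_prod_nonneg) auto
  also have "\<dots> = m - 2 * (\<Sum>x\<in>X. m * (t x)\<^sup>2)
      + (\<Sum>x\<in>X. \<Sum>y\<in>X. dot_prod n (v (Some x)) (v (Some y)) * G (Some x) (Some y))"
    using fin by (simp add: sum.reindex sum.distrib dN dNS N NS SN sum_negf)
  also have "\<dots> \<le> m - 2 * (\<Sum>x\<in>X. m * (t x)\<^sup>2) + (\<Sum>x\<in>X. m * (t x)\<^sup>2)"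
    by (intro add_left_mono sum_mono diag)
  finally have "(\<Sum>x\<in>X. m * (t x)\<^sup>2) \<le> m" by simp
  moreover have "m * (t x)\<^sup>2 = (dot_prod n c (u x))\<^sup>2 / m" for x
    using m by (simp add: t_def power2_eq_square field_simps)
  ultimately have "(\<Sum>x\<in>X. (dot_prod n c (u x))\<^sup>2) / m \<le> m"
    by (simp add: sum_divide_distrib)
  then show ?thesis using m by (simp add: m_def power2_eq_square field_simps)
qed simp

end

section \<open>Matrix algebras as C*-algebras\<close>

definition vec_norm :: "'i set \<Rightarrow> ('i \<Rightarrow> complex) \<Rightarrow> real" where
  "vec_norm I v = L2_set (\<lambda>i. cmod (v i)) I"

definition op_apply :: "'i set \<Rightarrow> 'i cmat \<Rightarrow> ('i \<Rightarrow> complex) \<Rightarrow> 'i \<Rightarrow> complex" where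
  "op_apply I T v = (\<lambda>i. \<Sum>j\<in>I. T i j * v j)"

text \<open>An infimum of bounds, rather than a supremum over unit vectors, also makes sense for
  empty \<open>I\<close>. The clause \<open>0 \<le> c\<close> keeps the set bounded below in that
  case too.\<close>

definition op_norm :: "'i set \<Rightarrow> 'i cmat \<Rightarrow> real" where
  "op_norm I T = Inf {c. 0 \<le> c \<and> (\<forall>v. vec_norm I (op_apply I T v) \<le> c * vec_norm I v)}"

definition op_adj :: "'i cmat \<Rightarrow> 'i cmat" where
  "op_adj T = (\<lambda>i j. cnj (T j i))"

definition op_id :: "'i set \<Rightarrow> 'i cmat" where
  "op_id I = (\<lambda>i j. if i = j \<and> i \<in> I then 1 else 0)"

lemma vec_norm_nonneg: "0 \<le> vec_norm I v"
  by (simp add: vec_norm_def)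

lemma vec_norm_triangle: "vec_norm I (\<lambda>i. u i + v i) \<le> vec_norm I u + vec_norm I v"
  unfolding vec_norm_def
  by (rule order_trans[OF L2_set_mono L2_set_triangle_ineq]) (auto intro: norm_triangle_ineq)

lemma vec_norm_scale: "vec_norm I (\<lambda>i. c * v i) = cmod c * vec_norm I v"
  unfolding vec_norm_def by (simp add: norm_mult L2_set_right_distrib)

lemma vec_norm_power2: "complex_of_real ((vec_norm I v)\<^sup>2) = (\<Sum>i\<in>I. cnj (v i) * v i)"
  unfolding vec_norm_def L2_set_def
  by (simp add: sum_nonneg complex_norm_square mult.commute del: of_real_power)

lemma vec_norm_cauchy_schwarz:
  "cmod (\<Sum>i\<in>I. cnj (u i) * v i) \<le> vec_norm I u * vec_norm I v"
proof -
  have "cmod (\<Sum>i\<in>I. cnj (u i) * v i) \<le> (\<Sum>i\<in>I. \<bar>cmod (u i)\<bar> * \<bar>cmod (v i)\<bar>)"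
    by (rule order_trans[OF norm_sum]) (simp add: norm_mult)
  then show ?thesis
    unfolding vec_norm_def by (rule order_trans[OF _ L2_set_mult_ineq])
qed

lemma op_apply_mult: "op_apply I (op_mult I S T) v = op_apply I S (op_apply I T v)"
proof
  fix i
  have "op_apply I (op_mult I S T) v i = (\<Sum>j\<in>I. \<Sum>k\<in>I. S i k * T k j * v j)"
    by (simp add: op_apply_def op_mult_def sum_distrib_right)
  also have "\<dots> = (\<Sum>k\<in>I. \<Sum>j\<in>I. S i k * T k j * v j)"
    by (rule sum.swap)
  finally show "op_apply I (op_mult I S T) v i = op_apply I S (op_apply I T v) i"
    by (simp add: op_apply_def sum_distrib_left mult.assoc)
qed

lemma op_mult_assoc: "op_mult I (op_mult I R S) T = op_mult I R (op_mult I S T)"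
proof -
  have "op_mult I (op_mult I R S) T i j = op_mult I R (op_mult I S T) i j" for i j
    unfolding op_mult_def sum_distrib_left sum_distrib_right mult.assoc by (rule sum.swap)
  then show ?thesis by blast
qed

lemma op_adj_adj: "op_adj (op_adj T) = T"
  by (simp add: op_adj_def)

lemma op_adj_mult: "op_adj (op_mult I S T) = op_mult I (op_adj T) (op_adj S)"
  by (simp add: op_adj_def op_mult_def mult.commute)

lemma op_mult_id_left:
  assumes "finite I" "T \<in> op_algebra I"
  shows "op_mult I (op_id I) T = T"
proof (intro ext)
  fix i j
  have "op_mult I (op_id I) T i j = (\<Sum>k\<in>I. if i = k then T i j else 0)"
    unfolding op_mult_def op_id_def by (intro sum.cong) auto
  then show "op_mult I (op_id I) T i j = T i j"
    using assms by (auto simp: op_algebra_def)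
qed

lemma op_mult_id_right:
  assumes "finite I" "T \<in> op_algebra I"
  shows "op_mult I T (op_id I) = T"
proof (intro ext)
  fix i j
  have "op_mult I T (op_id I) i j = (\<Sum>k\<in>I. if k = j then T i j else 0)"
    unfolding op_mult_def op_id_def by (intro sum.cong) auto
  then show "op_mult I T (op_id I) i j = T i j"
    using assms by (auto simp: op_algebra_def)
qed

lemma op_algebra_iff: "T \<in> op_algebra I \<longleftrightarrow> (\<forall>i j. i \<notin> I \<or> j \<notin> I \<longrightarrow> T i j = 0)"
  by (auto simp: op_algebra_def)

lemma op_mult_closed:
  "\<lbrakk>S \<in> op_algebra I; T \<in> op_algebra I\<rbrakk> \<Longrightarrow> op_mult I S T \<in> op_algebra I"
  by (auto simp: op_algebra_iff op_mult_def)

lemma op_algebra_closed: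
  shows "(\<lambda>i j. 0) \<in> op_algebra I"
    and "op_id I \<in> op_algebra I"
    and "\<lbrakk>S \<in> op_algebra I; T \<in> op_algebra I\<rbrakk> \<Longrightarrow> (\<lambda>i j. S i j + T i j) \<in> op_algebra I"
    and "T \<in> op_algebra I \<Longrightarrow> (\<lambda>i j. c * T i j) \<in> op_algebra I"
    and "T \<in> op_algebra I \<Longrightarrow> (\<lambda>i j. - T i j) \<in> op_algebra I"
    and "T \<in> op_algebra I \<Longrightarrow> op_adj T \<in> op_algebra I"
  by (auto simp: op_algebra_iff op_id_def op_adj_def)

section \<open>The operator norm and the C*-identity\<close>

context
  fixes I :: "'i set"
  assumes fin: "finite I"
begin

text \<open>A crude bound with two uses: the set defining \<open>op_norm\<close> is nonempty, and
  entrywise convergence implies convergence in norm.\<close>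

lemma vec_norm_apply_le_sum:
  "vec_norm I (op_apply I T v) \<le> (\<Sum>i\<in>I. \<Sum>j\<in>I. cmod (T i j)) * vec_norm I v"
proof -
  have "vec_norm I (op_apply I T v) \<le> (\<Sum>i\<in>I. cmod (op_apply I T v i))"
    unfolding vec_norm_def by (intro L2_set_le_sum) simp
  also have "\<dots> \<le> (\<Sum>i\<in>I. \<Sum>j\<in>I. cmod (T i j) * vec_norm I v)"
  proof (intro sum_mono)
    fix i
    have "cmod (op_apply I T v i) \<le> (\<Sum>j\<in>I. cmod (T i j) * cmod (v j))"
      unfolding op_apply_def by (rule order_trans[OF norm_sum]) (simp add: norm_mult)
    also have "\<dots> \<le> (\<Sum>j\<in>I. cmod (T i j) * vec_norm I v)"
      unfolding vec_norm_def using fin by (intro sum_mono mult_left_mono member_le_L2_set) auto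
    finally show "cmod (op_apply I T v i) \<le> (\<Sum>j\<in>I. cmod (T i j) * vec_norm I v)" .
  qed
  finally show ?thesis by (simp add: sum_distrib_right)
qed

lemma op_norm_leI:
  "\<lbrakk>0 \<le> c; \<And>v. vec_norm I (op_apply I T v) \<le> c * vec_norm I v\<rbrakk> \<Longrightarrow> op_norm I T \<le> c"
  unfolding op_norm_def by (rule cInf_lower) (auto intro: bdd_belowI[of _ 0])

lemma op_norm_le_sum: "op_norm I T \<le> (\<Sum>i\<in>I. \<Sum>j\<in>I. cmod (T i j))"
  by (intro op_norm_leI vec_norm_apply_le_sum sum_nonneg) auto

lemma op_norm_set_nonempty:
  "{c. 0 \<le> c \<and> (\<forall>v. vec_norm I (op_apply I T v) \<le> c * vec_norm I v)} \<noteq> {}"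
proof -
  have "(\<Sum>i\<in>I. \<Sum>j\<in>I. cmod (T i j)) \<in> {c. 0 \<le> c \<and> (\<forall>v. vec_norm I (op_apply I T v) \<le> c * vec_norm I v)}"
    using vec_norm_apply_le_sum by (simp add: sum_nonneg)
  then show ?thesis by blast
qed

lemma op_norm_nonneg: "0 \<le> op_norm I T"
  unfolding op_norm_def using op_norm_set_nonempty by (rule cInf_greatest) auto

text \<open>The infimum is itself a bound: for \<open>v\<close> of nonzero norm, the quotient of the
  norms lies below every admissible constant. For \<open>v\<close> of norm zero the crude bound
  forces the image to have norm zero.\<close>

lemma op_norm_apply: "vec_norm I (op_apply I T v) \<le> op_norm I T * vec_norm I v"
proof (cases "vec_norm I v = 0")
  case True
  then show ?thesis using vec_norm_apply_le_sum[of T v] by simp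
next
  case False
  then have pos: "vec_norm I v > 0" using vec_norm_nonneg[of I v] by simp
  have "vec_norm I (op_apply I T v) / vec_norm I v \<le> op_norm I T"
    unfolding op_norm_def using op_norm_set_nonempty
    by (rule cInf_greatest) (use pos in \<open>auto simp: field_simps\<close>)
  then show ?thesis using pos by (simp add: field_simps)
qed

lemma op_norm_entry:
  assumes "i \<in> I" "j \<in> I"
  shows "cmod (T i j) \<le> op_norm I T"
proof -
  let ?v = "\<lambda>k. if k = j then 1 else 0 :: complex"
  have "vec_norm I ?v = sqrt (\<Sum>k\<in>I. if k = j then 1 else 0)"
    unfolding vec_norm_def L2_set_def by (intro arg_cong[of _ _ sqrt] sum.cong) auto
  then have v: "vec_norm I ?v = 1" using fin assms by simp
  have "op_apply I T ?v i = T i j"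
    using fin assms by (simp add: op_apply_def if_distrib cong: if_cong)
  then have "cmod (T i j) \<le> vec_norm I (op_apply I T ?v)"
    unfolding vec_norm_def using fin assms member_le_L2_set[of I i "\<lambda>i. cmod (op_apply I T ?v i)"]
    by simp
  then show ?thesis using op_norm_apply[of T ?v] v by simp
qed

lemma op_norm_eq_0_iff: "T \<in> op_algebra I \<Longrightarrow> op_norm I T = 0 \<longleftrightarrow> T = (\<lambda>i j. 0)"
proof
  assume T: "T \<in> op_algebra I" "op_norm I T = 0"
  have "T i j = 0" for i j
    using op_norm_entry[of i j T] T by (cases "i \<in> I \<and> j \<in> I") (auto simp: op_algebra_def)
  then show "T = (\<lambda>i j. 0)" by blast
next
  assume "T = (\<lambda>i j. 0)"
  then show "op_norm I T = 0"
    using op_norm_le_sum[of T] op_norm_nonneg[of T] by simp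
qed

lemma op_norm_triangle: "op_norm I (\<lambda>i j. S i j + T i j) \<le> op_norm I S + op_norm I T"
proof (rule op_norm_leI)
  fix v
  have "op_apply I (\<lambda>i j. S i j + T i j) v = (\<lambda>i. op_apply I S v i + op_apply I T v i)"
    by (simp add: op_apply_def sum.distrib algebra_simps)
  then have "vec_norm I (op_apply I (\<lambda>i j. S i j + T i j) v)
      \<le> vec_norm I (op_apply I S v) + vec_norm I (op_apply I T v)"
    by (simp add: vec_norm_triangle)
  then show "vec_norm I (op_apply I (\<lambda>i j. S i j + T i j) v)
      \<le> (op_norm I S + op_norm I T) * vec_norm I v"
    using op_norm_apply[of S v] op_norm_apply[of T v] by (simp add: distrib_right)
qed (simp add: op_norm_nonneg)

lemma op_norm_scale_le: "op_norm I (\<lambda>i j. c * T i j) \<le> cmod c * op_norm I T"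
proof (rule op_norm_leI)
  fix v
  have "op_apply I (\<lambda>i j. c * T i j) v = (\<lambda>i. c * op_apply I T v i)"
    by (simp add: op_apply_def sum_distrib_left mult.assoc)
  then show "vec_norm I (op_apply I (\<lambda>i j. c * T i j) v) \<le> cmod c * op_norm I T * vec_norm I v"
    using op_norm_apply[of T v] by (simp add: vec_norm_scale mult.assoc mult_left_mono)
qed (simp add: op_norm_nonneg)

text \<open>The inequality missing from \<open>op_norm_scale_le\<close> follows by scaling back with
  \<open>inverse c\<close>.\<close>

lemma op_norm_scale: "op_norm I (\<lambda>i j. c * T i j) = cmod c * op_norm I T"
proof (cases "c = 0")
  case True
  then show ?thesis
    using op_norm_scale_le[of c T] op_norm_nonneg[of "\<lambda>i j. c * T i j"] by simp
next
  case False
  have "cmod c * op_norm I T \<le> cmod c * (cmod (inverse c) * op_norm I (\<lambda>i j. c * T i j))"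
    using op_norm_scale_le[of "inverse c" "\<lambda>i j. c * T i j"] False
    by (intro mult_left_mono) (simp_all add: mult.assoc[symmetric])
  also have "\<dots> = op_norm I (\<lambda>i j. c * T i j)"
    using False by (simp add: norm_inverse mult.assoc[symmetric])
  finally show ?thesis using op_norm_scale_le[of c T] by simp
qed

lemma op_norm_mult: "op_norm I (op_mult I S T) \<le> op_norm I S * op_norm I T"
proof (rule op_norm_leI)
  fix v
  have "vec_norm I (op_apply I (op_mult I S T) v) \<le> op_norm I S * vec_norm I (op_apply I T v)"
    by (simp add: op_apply_mult op_norm_apply)
  also have "\<dots> \<le> op_norm I S * (op_norm I T * vec_norm I v)"
    by (intro mult_left_mono op_norm_apply op_norm_nonneg)
  finally show "vec_norm I (op_apply I (op_mult I S T) v) \<le> op_norm I S * op_norm I T * vec_norm I v"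
    by (simp add: mult.assoc)
qed (simp add: op_norm_nonneg)

text \<open>Since |Tv|^2 = <T^* T v, v>, the Cauchy-Schwarz inequality bounds it by the norm of T^*
  T times |v|^2.\<close>

lemma op_norm_power2_le: "(op_norm I T)\<^sup>2 \<le> op_norm I (op_mult I (op_adj T) T)"
proof -
  let ?N = "op_norm I (op_mult I (op_adj T) T)"
  have "vec_norm I (op_apply I T v) \<le> sqrt ?N * vec_norm I v" for v
  proof -
    let ?w = "op_apply I T v"
    have "cnj (?w i) = (\<Sum>j\<in>I. cnj (v j) * cnj (T i j))" for i
      by (simp add: op_apply_def mult.commute)
    then have "(\<Sum>i\<in>I. cnj (?w i) * ?w i) = (\<Sum>i\<in>I. \<Sum>j\<in>I. cnj (v j) * (cnj (T i j) * ?w i))"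
      by (simp add: sum_distrib_right mult.assoc)
    also have "\<dots> = (\<Sum>j\<in>I. \<Sum>i\<in>I. cnj (v j) * (cnj (T i j) * ?w i))"
      by (rule sum.swap)
    also have "\<dots> = (\<Sum>j\<in>I. cnj (v j) * op_apply I (op_mult I (op_adj T) T) v j)"
      unfolding op_apply_mult op_apply_def[of I "op_adj T"]
      by (simp add: op_adj_def sum_distrib_left)
    finally have "(vec_norm I ?w)\<^sup>2 = cmod (\<Sum>j\<in>I. cnj (v j) * op_apply I (op_mult I (op_adj T) T) v j)"
      using vec_norm_power2[of I ?w]
      by (metis norm_of_real abs_of_nonneg zero_le_power2)
    also have "\<dots> \<le> vec_norm I v * (?N * vec_norm I v)"
      by (intro order_trans[OF vec_norm_cauchy_schwarz] mult_left_mono op_norm_apply vec_norm_nonneg)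
    also have "\<dots> = (sqrt ?N * vec_norm I v)\<^sup>2"
      by (simp add: power_mult_distrib op_norm_nonneg power2_eq_square)
    finally show ?thesis
      by (rule power2_le_imp_le) (simp add: op_norm_nonneg vec_norm_nonneg)
  qed
  then have "op_norm I T \<le> sqrt ?N"
    by (intro op_norm_leI) (simp_all add: op_norm_nonneg)
  then have "(op_norm I T)\<^sup>2 \<le> (sqrt ?N)\<^sup>2"
    by (intro power_mono op_norm_nonneg)
  then show ?thesis by (simp add: op_norm_nonneg)
qed

text \<open>A factor |T| is cancelled in |T|^2 \<le> |T^* T| \<le> |T^*| |T|.\<close>

lemma op_norm_le_adj: "op_norm I T \<le> op_norm I (op_adj T)"
proof (cases "op_norm I T = 0")
  case False
  have "op_norm I T * op_norm I T \<le> op_norm I (op_adj T) * op_norm I T"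
    using op_norm_power2_le[of T] op_norm_mult[of "op_adj T" T] by (simp add: power2_eq_square)
  then show ?thesis
    using False op_norm_nonneg[of T] by simp
qed (simp add: op_norm_nonneg)

lemma op_norm_adj: "op_norm I (op_adj T) = op_norm I T"
  using op_norm_le_adj[of T] op_norm_le_adj[of "op_adj T"] by (simp add: op_adj_adj)

lemma op_norm_cstar: "op_norm I (op_mult I (op_adj T) T) = (op_norm I T)\<^sup>2"
  using op_norm_power2_le[of T] op_norm_mult[of "op_adj T" T]
  by (simp add: op_norm_adj power2_eq_square)

text \<open>Entries are dominated by the norm, so they form Cauchy sequences. The matrix of their
  limits is also the limit in norm, because the norm is at most the finite sum of the moduli of the
  entries.\<close>

lemma op_norm_complete:
  fixes S :: "nat \<Rightarrow> 'i cmat"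
  assumes S: "\<And>n. S n \<in> op_algebra I"
    and cauchy: "\<And>e. e > 0 \<Longrightarrow> \<exists>N. \<forall>m\<ge>N. \<forall>n\<ge>N. op_norm I (\<lambda>i j. S m i j - S n i j) < e"
  shows "\<exists>L\<in>op_algebra I. (\<lambda>n. op_norm I (\<lambda>i j. S n i j - L i j)) \<longlonglongrightarrow> 0"
proof -
  have "\<exists>l. (\<lambda>n. S n i j) \<longlonglongrightarrow> l" if "i \<in> I" "j \<in> I" for i j
  proof -
    have "Cauchy (\<lambda>n. S n i j)"
    proof (rule metric_CauchyI)
      fix e :: real assume "e > 0"
      then obtain N where "\<And>m n. \<lbrakk>m \<ge> N; n \<ge> N\<rbrakk> \<Longrightarrow> op_norm I (\<lambda>i j. S m i j - S n i j) < e"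
        using cauchy by blast
      then show "\<exists>M. \<forall>m\<ge>M. \<forall>n\<ge>M. dist (S m i j) (S n i j) < e"
        unfolding dist_norm using op_norm_entry[OF that] le_less_trans by (metis (no_types, lifting))
    qed
    then show ?thesis by (simp add: Cauchy_convergent_iff convergent_def)
  qed
  then obtain l where l: "\<And>i j. \<lbrakk>i \<in> I; j \<in> I\<rbrakk> \<Longrightarrow> (\<lambda>n. S n i j) \<longlonglongrightarrow> l i j" by metis
  define L where "L i j = (if i \<in> I \<and> j \<in> I then l i j else 0)" for i j
  have "L \<in> op_algebra I" by (simp add: L_def op_algebra_def)
  moreover have "(\<lambda>n. op_norm I (\<lambda>i j. S n i j - L i j)) \<longlonglongrightarrow> 0"
  proof (rule tendsto_sandwich[OF _ _ tendsto_const])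
    show "(\<lambda>n. \<Sum>i\<in>I. \<Sum>j\<in>I. cmod (S n i j - L i j)) \<longlonglongrightarrow> 0"
      using l by (intro tendsto_null_sum) (simp add: L_def LIM_zero_iff tendsto_norm_zero)
  qed (auto intro!: always_eventually simp: op_norm_nonneg op_norm_le_sum)
  ultimately show ?thesis by blast
qed

end

text \<open>
  The elements of the algebra have to be drawn from the type \<open>'u\<close>, hence the transport of
  \<open>op_algebra I\<close> along an injection \<open>e\<close>.
\<close>

definition matrix_cstar :: "('i cmat \<Rightarrow> 'u) \<Rightarrow> 'i set \<Rightarrow> 'u cstar_struct" where
  "matrix_cstar e I =
     \<lparr>carrier = e ` op_algebra I,
      monoid.mult = \<lambda>x y. e (op_mult I (the_inv e x) (the_inv e y)),
      one = e (op_id I),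
      zero = e (\<lambda>i j. 0),
      add = \<lambda>x y. e (\<lambda>i j. the_inv e x i j + the_inv e y i j),
      smult = \<lambda>c x. e (\<lambda>i j. c * the_inv e x i j),
      adj = \<lambda>x. e (op_adj (the_inv e x)),
      alg_norm = \<lambda>x. op_norm I (the_inv e x)\<rparr>"

definition matrix_trace :: "('i cmat \<Rightarrow> 'u) \<Rightarrow> 'i set \<Rightarrow> 'u \<Rightarrow> complex" where
  "matrix_trace e I x = op_trace I (the_inv e x) / of_nat (card I)"

section \<open>The transported matrix algebra as a finite-dimensional C*-algebra with trace\<close>

lemma cring_complex_ring: "cring complex_ring"
proof (rule cringI)
  show "abelian_group complex_ring"
  proof (rule abelian_groupI)
    fix x :: complex
    show "\<exists>y\<in>carrier complex_ring. y \<oplus>\<^bsub>complex_ring\<^esub> x = \<zero>\<^bsub>complex_ring\<^esub>"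
      by (rule bexI[of _ "- x"]) (simp_all add: complex_ring_def)
  qed (simp_all add: complex_ring_def)
  show "comm_monoid complex_ring"
    by (rule comm_monoidI) (simp_all add: complex_ring_def)
qed (simp add: complex_ring_def distrib_right)

context
  fixes e :: "'i cmat \<Rightarrow> 'u" and I :: "'i set"
  assumes inj: "inj e" and fin: "finite I"
begin

lemma matrix_cstar_simps:
  "carrier (matrix_cstar e I) = e ` op_algebra I"
  "e S \<otimes>\<^bsub>matrix_cstar e I\<^esub> e T = e (op_mult I S T)"
  "\<one>\<^bsub>matrix_cstar e I\<^esub> = e (op_id I)"
  "\<zero>\<^bsub>matrix_cstar e I\<^esub> = e (\<lambda>i j. 0)"
  "e S \<oplus>\<^bsub>matrix_cstar e I\<^esub> e T = e (\<lambda>i j. S i j + T i j)"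
  "c \<odot>\<^bsub>matrix_cstar e I\<^esub> e T = e (\<lambda>i j. c * T i j)"
  "adj (matrix_cstar e I) (e T) = e (op_adj T)"
  "alg_norm (matrix_cstar e I) (e T) = op_norm I T"
  using inj by (simp_all add: matrix_cstar_def the_inv_f_f)

lemma matrix_cstar_abelian_group: "abelian_group (matrix_cstar e I)"
proof (rule abelian_groupI)
  fix x assume "x \<in> carrier (matrix_cstar e I)"
  then obtain T where "x = e T" "T \<in> op_algebra I" by (auto simp: matrix_cstar_simps)
  then show "\<exists>y\<in>carrier (matrix_cstar e I). y \<oplus>\<^bsub>matrix_cstar e I\<^esub> x = \<zero>\<^bsub>matrix_cstar e I\<^esub>"
    by (intro bexI[of _ "e (\<lambda>i j. - T i j)"]) (auto simp: matrix_cstar_simps op_algebra_closed op_mult_closed)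
qed (auto simp: matrix_cstar_simps op_algebra_closed op_mult_closed add_ac)

lemma matrix_cstar_ring: "ring (matrix_cstar e I)"
proof (rule ringI[OF matrix_cstar_abelian_group])
  show "monoid (matrix_cstar e I)"
    by (rule monoidI)
      (auto simp: matrix_cstar_simps op_algebra_closed op_mult_closed op_mult_assoc op_mult_id_left op_mult_id_right fin)
qed (auto simp: matrix_cstar_simps op_algebra_closed op_mult_closed, auto simp: op_mult_def sum.distrib algebra_simps)

lemma matrix_cstar_module: "module complex_ring (matrix_cstar e I)"
  by (rule moduleI[OF cring_complex_ring matrix_cstar_abelian_group])
    (auto simp: matrix_cstar_simps op_algebra_closed op_mult_closed complex_ring_def algebra_simps)

lemma matrix_cstar_minus:
  assumes "S \<in> op_algebra I" "T \<in> op_algebra I"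
  shows "e S \<ominus>\<^bsub>matrix_cstar e I\<^esub> e T = e (\<lambda>i j. S i j - T i j)"
proof -
  interpret abelian_group "matrix_cstar e I" by (rule matrix_cstar_abelian_group)
  have "\<ominus>\<^bsub>matrix_cstar e I\<^esub> e T = e (\<lambda>i j. - T i j)"
    using assms by (intro minus_equality) (auto simp: matrix_cstar_simps op_algebra_closed op_mult_closed)
  then show ?thesis by (simp add: a_minus_def matrix_cstar_simps)
qed

lemma matrix_cstar_finsum:
  assumes "finite J" "\<And>k. k \<in> J \<Longrightarrow> f k \<in> op_algebra I"
  shows "(\<Oplus>\<^bsub>matrix_cstar e I\<^esub> k\<in>J. e (f k)) = e (\<lambda>i j. \<Sum>k\<in>J. f k i j)"
proof -
  interpret abelian_group "matrix_cstar e I" by (rule matrix_cstar_abelian_group)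
  show ?thesis using assms
    by (induction rule: finite_induct) (auto simp: matrix_cstar_simps Pi_iff)
qed

lemma unital_cstar_algebra_matrix_cstar: "unital_cstar_algebra (matrix_cstar e I)"
proof -
  interpret M: module complex_ring "matrix_cstar e I" by (rule matrix_cstar_module)
  interpret R: ring "matrix_cstar e I" by (rule matrix_cstar_ring)
  show ?thesis
  proof unfold_locales
    fix s :: "nat \<Rightarrow> 'u"
    assume s: "\<And>n. s n \<in> carrier (matrix_cstar e I)"
      and cauchy: "\<And>\<epsilon>. \<epsilon> > 0 \<Longrightarrow>
        \<exists>N. \<forall>m\<ge>N. \<forall>n\<ge>N. alg_norm (matrix_cstar e I) (s m \<ominus>\<^bsub>matrix_cstar e I\<^esub> s n) < \<epsilon>"
    have "\<forall>n. \<exists>T. s n = e T \<and> T \<in> op_algebra I"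
      using s by (auto simp: matrix_cstar_simps image_iff)
    then obtain S where S: "s = (\<lambda>n. e (S n))" "\<And>n. S n \<in> op_algebra I" by metis
    then obtain L where "L \<in> op_algebra I" "(\<lambda>n. op_norm I (\<lambda>i j. S n i j - L i j)) \<longlonglongrightarrow> 0"
      using op_norm_complete[OF fin, of S] cauchy
      by (auto simp: matrix_cstar_minus matrix_cstar_simps)
    then show "\<exists>x\<in>carrier (matrix_cstar e I).
        (\<lambda>n. alg_norm (matrix_cstar e I) (s n \<ominus>\<^bsub>matrix_cstar e I\<^esub> x)) \<longlonglongrightarrow> 0"
      using S by (intro bexI[of _ "e L"]) (auto simp: matrix_cstar_minus matrix_cstar_simps)
  next
    fix x c assume "x \<in> carrier (matrix_cstar e I)"
    then show "adj (matrix_cstar e I) (c \<odot>\<^bsub>matrix_cstar e I\<^esub> x) =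
        cnj c \<odot>\<^bsub>matrix_cstar e I\<^esub> adj (matrix_cstar e I) x"
      by (auto simp: matrix_cstar_simps op_adj_def)
  next
    fix x y assume "x \<in> carrier (matrix_cstar e I)" "y \<in> carrier (matrix_cstar e I)"
    then show "adj (matrix_cstar e I) (x \<oplus>\<^bsub>matrix_cstar e I\<^esub> y) =
        adj (matrix_cstar e I) x \<oplus>\<^bsub>matrix_cstar e I\<^esub> adj (matrix_cstar e I) y"
      by (auto simp: matrix_cstar_simps op_adj_def)
  next
    fix x y c assume "x \<in> carrier (matrix_cstar e I)" "y \<in> carrier (matrix_cstar e I)"
    then show "(c \<odot>\<^bsub>matrix_cstar e I\<^esub> x) \<otimes>\<^bsub>matrix_cstar e I\<^esub> y =
        c \<odot>\<^bsub>matrix_cstar e I\<^esub> (x \<otimes>\<^bsub>matrix_cstar e I\<^esub> y)"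
      "x \<otimes>\<^bsub>matrix_cstar e I\<^esub> (c \<odot>\<^bsub>matrix_cstar e I\<^esub> y) =
        c \<odot>\<^bsub>matrix_cstar e I\<^esub> (x \<otimes>\<^bsub>matrix_cstar e I\<^esub> y)"
      by (auto simp: matrix_cstar_simps op_mult_def sum_distrib_left mult_ac)
  qed (auto simp: matrix_cstar_simps op_algebra_closed op_mult_closed op_adj_adj op_adj_mult op_norm_nonneg[OF fin]
      op_norm_eq_0_iff[OF fin] op_norm_triangle[OF fin] op_norm_scale[OF fin] op_norm_mult[OF fin]
      op_norm_cstar[OF fin] inj_eq[OF inj])
qed

lemma matrix_trace_image: "matrix_trace e I (e T) = op_trace I T / of_nat (card I)"
  using inj by (simp add: matrix_trace_def the_inv_f_f)

lemma tracial_state_matrix_trace: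
  assumes "I \<noteq> {}"
  shows "tracial_state (matrix_cstar e I) (matrix_trace e I)"
proof -
  have nonneg: "op_trace I (op_mult I (op_adj T) T) / of_nat (card I) \<in> \<real>\<^sub>\<ge>\<^sub>0" for T
  proof -
    have "op_trace I (op_mult I (op_adj T) T) / of_nat (card I) =
        complex_of_real ((\<Sum>i\<in>I. \<Sum>k\<in>I. (cmod (T k i))\<^sup>2) / card I)"
      by (simp add: op_trace_def op_mult_def op_adj_def complex_norm_square mult.commute
          del: of_real_power)
    also have "\<dots> \<in> \<real>\<^sub>\<ge>\<^sub>0"
      by (simp only: nonneg_Reals_of_real_iff) (simp add: sum_nonneg)
    finally show ?thesis .
  qed
  have commute: "op_trace I (op_mult I S T) = op_trace I (op_mult I T S)" for S T
    unfolding op_trace_def op_mult_def by (subst sum.swap) (simp add: mult.commute)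
  have one: "op_trace I (op_id I) = of_nat (card I)"
    by (simp add: op_trace_def op_id_def)
  have add: "op_trace I (\<lambda>i j. S i j + T i j) = op_trace I S + op_trace I T" for S T
    by (simp add: op_trace_def sum.distrib)
  have scale: "op_trace I (\<lambda>i j. c * T i j) = c * op_trace I T" for c T
    by (simp add: op_trace_def sum_distrib_left)
  show ?thesis
    unfolding tracial_state_def
  proof (intro conjI ballI allI)
    fix x y assume "x \<in> carrier (matrix_cstar e I)" "y \<in> carrier (matrix_cstar e I)"
    then obtain S T where xy: "x = e S" "y = e T"
      by (auto simp: matrix_cstar_simps)
    show "matrix_trace e I (x \<oplus>\<^bsub>matrix_cstar e I\<^esub> y) = matrix_trace e I x + matrix_trace e I y"
      by (simp add: xy matrix_cstar_simps matrix_trace_image add add_divide_distrib)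
    show "matrix_trace e I (x \<otimes>\<^bsub>matrix_cstar e I\<^esub> y) = matrix_trace e I (y \<otimes>\<^bsub>matrix_cstar e I\<^esub> x)"
      by (simp only: xy matrix_cstar_simps matrix_trace_image commute[of S T])
  next
    fix x c assume "x \<in> carrier (matrix_cstar e I)"
    then obtain T where x: "x = e T"
      by (auto simp: matrix_cstar_simps)
    show "matrix_trace e I (c \<odot>\<^bsub>matrix_cstar e I\<^esub> x) = c * matrix_trace e I x"
      by (simp add: x matrix_cstar_simps matrix_trace_image scale)
  next
    fix x assume "x \<in> carrier (matrix_cstar e I)"
    then obtain T where x: "x = e T"
      by (auto simp: matrix_cstar_simps)
    show "matrix_trace e I (adj (matrix_cstar e I) x \<otimes>\<^bsub>matrix_cstar e I\<^esub> x) \<in> \<real>\<^sub>\<ge>\<^sub>0"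
      using nonneg[of T] by (simp add: x matrix_cstar_simps matrix_trace_image)
  next
    show "matrix_trace e I \<one>\<^bsub>matrix_cstar e I\<^esub> = 1"
      using fin assms by (simp add: matrix_cstar_simps matrix_trace_image one)
  qed
qed

lemma finite_dim_matrix_cstar: "finite_dim_algebra (matrix_cstar e I)"
proof -
  define \<phi> where "\<phi> = (\<lambda>(i, j). e (matrix_unit i j))"
  have unit: "matrix_unit i j \<in> op_algebra I" if "i \<in> I" "j \<in> I" for i j
    using that by (auto simp: matrix_unit_def op_algebra_def split: if_splits)
  have inj_unit: "inj_on \<phi> (I \<times> I)"
  proof (rule inj_onI, clarify)
    fix i j k l assume "\<phi> (i, j) = \<phi> (k, l)"
    then have "matrix_unit i j = matrix_unit k l" using inj by (simp add: \<phi>_def inj_eq)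
    then have "matrix_unit i j i j = matrix_unit k l i j" by simp
    then show "i = k \<and> j = l" by (auto simp: matrix_unit_def split: if_splits)
  qed
  show ?thesis
    unfolding finite_dim_algebra_def
  proof (intro exI[of _ "\<phi> ` (I \<times> I)"] conjI ballI)
    fix x assume "x \<in> carrier (matrix_cstar e I)"
    then obtain T where T: "x = e T" "T \<in> op_algebra I" by (auto simp: matrix_cstar_simps)
    \<comment> \<open>\<open>finite_dim_algebra\<close> indexes coefficients by elements of the
      spanning set, so the index pair of a matrix unit is recovered through the inverse of the
      injective \<open>\<phi>\<close>.\<close>
    define c where "c s = (case inv_into (I \<times> I) \<phi> s of (i, j) \<Rightarrow> T i j)" for s
    have c: "c (\<phi> (i, j)) = T i j" if "i \<in> I" "j \<in> I" for i j
      using that inj_unit by (simp add: c_def inv_into_f_f)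
    have inv: "the_inv e (\<phi> (i, j)) = matrix_unit i j" for i j
      using inj by (simp add: \<phi>_def the_inv_f_f)
    have "(\<Oplus>\<^bsub>matrix_cstar e I\<^esub> s\<in>\<phi> ` (I \<times> I). c s \<odot>\<^bsub>matrix_cstar e I\<^esub> s) =
        (\<Oplus>\<^bsub>matrix_cstar e I\<^esub> s\<in>\<phi> ` (I \<times> I). e (\<lambda>k l. c s * the_inv e s k l))"
      by (simp add: matrix_cstar_def)
    also have "\<dots> = e (\<lambda>k l. \<Sum>s\<in>\<phi> ` (I \<times> I). c s * the_inv e s k l)"
      using fin unit by (intro matrix_cstar_finsum) (auto simp: inv op_algebra_closed op_mult_closed)
    also have "(\<lambda>k l. \<Sum>s\<in>\<phi> ` (I \<times> I). c s * the_inv e s k l) = T"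
    proof (intro ext)
      fix k l
      have "(\<Sum>s\<in>\<phi> ` (I \<times> I). c s * the_inv e s k l) =
          (\<Sum>i\<in>I. \<Sum>j\<in>I. T i j * matrix_unit i j k l)"
        unfolding sum.reindex[OF inj_unit] sum.cartesian_product
        by (rule sum.cong) (auto simp: c inv)
      also have "\<dots> = (\<Sum>i\<in>I. if i = k then T k l else 0)"
      proof (rule sum.cong[OF refl])
        fix i
        have "(\<Sum>j\<in>I. T i j * matrix_unit i j k l) = (\<Sum>j\<in>I. if j = l then if i = k then T k l else 0 else 0)"
          by (rule sum.cong) (auto simp: matrix_unit_def)
        also have "\<dots> = (if i = k then T k l else 0)"
          using fin T by (auto simp: op_algebra_iff)
        finally show "(\<Sum>j\<in>I. T i j * matrix_unit i j k l) = (if i = k then T k l else 0)" .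
      qed
      also have "\<dots> = T k l"
        using fin T by (auto simp: op_algebra_iff)
      finally show "(\<Sum>s\<in>\<phi> ` (I \<times> I). c s * the_inv e s k l) = T k l" .
    qed
    finally show "\<exists>c. x = (\<Oplus>\<^bsub>matrix_cstar e I\<^esub> s\<in>\<phi> ` (I \<times> I). c s \<odot>\<^bsub>matrix_cstar e I\<^esub> s)"
      using T by metis
  qed (use fin unit in \<open>auto simp: \<phi>_def matrix_cstar_simps\<close>)
qed

end

text \<open>A matrix consists of countably many real numbers. Each is turned into a set of naturals
  by \<open>r\<close> and tagged with its position; the union, encoded as one set of naturals,
  determines the matrix and is sent to a real and then into \<open>'u\<close>.\<close>

lemma nat_cmat_embedding:
  assumes "(UNIV :: real set) \<lesssim> (UNIV :: 'u set)"
  shows "\<exists>e :: nat cmat \<Rightarrow> 'u. inj e"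
proof -
  obtain r :: "real \<Rightarrow> nat set" where r: "inj r"
    using nat_sets_eqpoll_reals by (metis eqpoll_imp_lepoll eqpoll_sym lepoll_def)
  obtain s :: "nat set \<Rightarrow> real" where s: "inj s"
    using nat_sets_eqpoll_reals by (metis eqpoll_imp_lepoll lepoll_def)
  obtain t :: "real \<Rightarrow> 'u" where t: "inj t"
    using assms by (auto simp: lepoll_def)
  define code :: "nat cmat \<Rightarrow> (nat \<times> nat \<times> bool \<times> nat) set" where
    "code T = {(i, j, b, n). n \<in> r (if b then Re (T i j) else Im (T i j))}" for T
  have "inj code"
  proof (rule injI)
    fix S T assume eq: "code S = code T"
    have "r (if b then Re (S i j) else Im (S i j)) = r (if b then Re (T i j) else Im (T i j))" for i j b
    proof (rule Set.set_eqI)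
      fix n
      show "n \<in> r (if b then Re (S i j) else Im (S i j)) \<longleftrightarrow>
            n \<in> r (if b then Re (T i j) else Im (T i j))"
        using arg_cong[OF eq, of "\<lambda>C. (i, j, b, n) \<in> C"] by (simp add: code_def)
    qed
    from this[of True] this[of False] show "S = T"
      using r by (simp add: inj_eq complex_eq_iff fun_eq_iff)
  qed
  moreover have "inj (\<lambda>C :: (nat \<times> nat \<times> bool \<times> nat) set. to_nat ` C)"
    by (intro injI) (simp add: inj_image_eq_iff)
  ultimately have "inj (t \<circ> s \<circ> (\<lambda>C. to_nat ` C) \<circ> code)"
    using s t by (intro inj_compose)
  then show ?thesis by blast
qed

section \<open>Colourings from families of frames\<close>

lemma tensor_matrix_unit:
  "tensor (matrix_unit a a') (matrix_unit b b') = matrix_unit (a, b) (a', b')"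
  by (auto simp: tensor_def matrix_unit_def fun_eq_iff)

lemma sum_tensor_matrix_unit:
  assumes "finite A"
  shows "(\<Sum>a\<in>A. \<Sum>a'\<in>A. \<Sum>b\<in>A. \<Sum>b'\<in>A. f a a' b b' * tensor (matrix_unit a a') (matrix_unit b b') p q) =
    (if p \<in> A \<times> A \<and> q \<in> A \<times> A then f (fst p) (fst q) (snd p) (snd q) else 0)"
proof -
  \<comment> \<open>The conditions are nested in the order in which the sums collapse, the innermost
    sum first.\<close>
  have "f a a' b b' * tensor (matrix_unit a a') (matrix_unit b b') p q =
      (if b' = snd q then if b = snd p then if a' = fst q then if a = fst p
        then f (fst p) (fst q) (snd p) (snd q) else 0 else 0 else 0 else 0)" for a a' b b'
    by (auto simp: tensor_def matrix_unit_def)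
  then show ?thesis
    using assms
    by (cases "snd q \<in> A"; cases "snd p \<in> A"; cases "fst q \<in> A"; cases "fst p \<in> A")
      (simp_all add: mem_Times_iff)
qed

lemma Omega_eq:
  assumes "finite A"
  shows "Omega A p q = (if fst p = snd p \<and> fst q = snd q \<and> fst p \<in> A \<and> fst q \<in> A then 1 else 0)"
proof -
  have "tensor (matrix_unit a b) (matrix_unit a b) p q =
      (if b = fst q then if a = fst p then if fst p = snd p \<and> fst q = snd q then 1 else 0 else 0 else 0)"
    for a b by (auto simp: tensor_def matrix_unit_def)
  then show ?thesis
    using assms by (cases "fst q \<in> A"; cases "fst p \<in> A") (simp_all add: Omega_def)
qed

lemma sum_Times: "(\<Sum>p\<in>A\<times>B. f p) = (\<Sum>a\<in>A. \<Sum>b\<in>B. f (a, b))"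
  by (simp add: sum.cartesian_product split_def)

text \<open>For a tracial realisation, this turns properness at an edge into the vanishing of the
  sum of all \<open>\<tau> (g x a a' \<otimes> g y a' a)\<close>, the GNS inner product of g_x and
  g_y.\<close>

lemma op_pairing_Omega:
  assumes "finite A"
  shows "op_pairing (A \<times> A) S (Omega A) = (\<Sum>a\<in>A. \<Sum>a'\<in>A. S (a, a) (a', a'))"
proof -
  have "(\<Sum>q\<in>A\<times>A. S p q * Omega A p q) = (if fst p = snd p then \<Sum>a'\<in>A. S p (a', a') else 0)"
    if "p \<in> A \<times> A" for p
  proof -
    have "(\<Sum>q\<in>A\<times>A. S p q * Omega A p q) =
        (\<Sum>a'\<in>A. \<Sum>b'\<in>A. if b' = a' then if fst p = snd p then S p (a', a') else 0 else 0)"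
      unfolding sum_Times using that assms by (intro sum.cong refl) (auto simp: Omega_eq)
    also have "\<dots> = (\<Sum>a'\<in>A. if fst p = snd p then S p (a', a') else 0)"
      using assms by (intro sum.cong) auto
    finally show ?thesis by simp
  qed
  then have "op_pairing (A \<times> A) S (Omega A) =
      (\<Sum>p\<in>A\<times>A. if fst p = snd p then \<Sum>a'\<in>A. S p (a', a') else 0)"
    by (simp add: op_pairing_def op_trace_def op_mult_def op_transpose_def)
  also have "\<dots> = (\<Sum>a\<in>A. \<Sum>b\<in>A. if b = a then \<Sum>a'\<in>A. S (a, a) (a', a') else 0)"
    unfolding sum_Times by (intro sum.cong refl) auto
  also have "\<dots> = (\<Sum>a\<in>A. \<Sum>a'\<in>A. S (a, a) (a', a'))"
    by (rule sum.cong[OF refl]) (use assms in simp)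
  finally show ?thesis .
qed

section \<open>Measure-and-prepare channels\<close>

lemma sum_times_delta_snd:
  fixes F :: "'k \<times> 'z \<Rightarrow> complex"
  assumes "finite Z" "z \<in> Z"
  shows "(\<Sum>q\<in>K\<times>Z. F q * (if snd q = z then u (fst q) else 0)) = (\<Sum>l\<in>K. F (l, z) * u l)"
proof -
  have "(\<Sum>q\<in>K\<times>Z. F q * (if snd q = z then u (fst q) else 0)) =
      (\<Sum>l\<in>K. \<Sum>z'\<in>Z. if z' = z then F (l, z) * u l else 0)"
    unfolding sum_Times by (intro sum.cong refl) auto
  then show ?thesis using assms by simp
qed

text \<open>Positivity of \<open>T\<close> is tested on the vectors u \<otimes> e_z.\<close>

lemma op_positive_block_diagonal:
  assumes "finite Z" "z \<in> Z" "op_positive (K \<times> Z) T"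
  shows "(\<Sum>k\<in>K. \<Sum>l\<in>K. cnj (u k) * T (k, z) (l, z) * u l) \<in> \<real>\<^sub>\<ge>\<^sub>0"
proof -
  let ?v = "\<lambda>q. if snd q = z then u (fst q) else 0"
  have "(\<Sum>p\<in>K\<times>Z. \<Sum>q\<in>K\<times>Z. cnj (?v p) * T p q * ?v q) =
      (\<Sum>p\<in>K\<times>Z. \<Sum>l\<in>K. cnj (?v p) * T p (l, z) * u l)"
    using sum_times_delta_snd[OF assms(1,2), of _ u K] by (intro sum.cong refl) simp
  also have "\<dots> = (\<Sum>l\<in>K. \<Sum>p\<in>K\<times>Z. T p (l, z) * u l * (if snd p = z then cnj (u (fst p)) else 0))"
    by (subst sum.swap) (intro sum.cong refl, simp)
  also have "\<dots> = (\<Sum>l\<in>K. \<Sum>k\<in>K. T (k, z) (l, z) * u l * cnj (u k))"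
    by (simp only: sum_times_delta_snd[OF assms(1,2), of _ "\<lambda>k. cnj (u k)" K])
  also have "\<dots> = (\<Sum>l\<in>K. \<Sum>k\<in>K. cnj (u k) * T (k, z) (l, z) * u l)"
    by (simp add: mult_ac)
  also have "\<dots> = (\<Sum>k\<in>K. \<Sum>l\<in>K. cnj (u k) * T (k, z) (l, z) * u l)"
    by (rule sum.swap)
  finally have eq: "(\<Sum>p\<in>K\<times>Z. \<Sum>q\<in>K\<times>Z. cnj (?v p) * T p q * ?v q) =
      (\<Sum>k\<in>K. \<Sum>l\<in>K. cnj (u k) * T (k, z) (l, z) * u l)" .
  have "(\<Sum>p\<in>K\<times>Z. \<Sum>q\<in>K\<times>Z. cnj (?v p) * T p q * ?v q) \<in> \<real>\<^sub>\<ge>\<^sub>0"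
    using assms(3) unfolding op_positive_def by (elim conjE allE[of _ ?v])
  then show ?thesis by (simp only: eq)
qed

text \<open>\<open>\<Phi>\<close> measures in the canonical basis and prepares the pure state with
  vector \<open>w z\<close> upon outcome \<open>z\<close>. Complete positivity reduces to positivity
  of the diagonal blocks of the input.\<close>

lemma channel_on_measure_prepare:
  fixes w :: "'z \<Rightarrow> 'j \<Rightarrow> complex"
  assumes fin: "finite Z" "finite J"
    and supp: "\<And>z p. p \<notin> J \<Longrightarrow> w z p = 0"
    and norm: "\<And>z. z \<in> Z \<Longrightarrow> (\<Sum>p\<in>J. w z p * cnj (w z p)) = 1"
  defines "\<Phi> \<equiv> \<lambda>T p q. \<Sum>z\<in>Z. T z z * (w z p * cnj (w z q))"
  shows "channel_on Z J (diag_algebra Z) \<Phi>"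
  unfolding channel_on_def
proof (intro conjI ballI)
  show "\<Phi> ` diag_algebra Z \<subseteq> op_algebra J"
    using supp by (auto simp: \<Phi>_def op_algebra_iff)
  show "linear_map_on (diag_algebra Z) \<Phi>"
    by (auto simp: linear_map_on_def \<Phi>_def fun_eq_iff sum.distrib sum_distrib_left algebra_simps)
  show "op_trace J (\<Phi> T) = op_trace Z T" for T
  proof -
    have "op_trace J (\<Phi> T) = (\<Sum>z\<in>Z. \<Sum>p\<in>J. T z z * (w z p * cnj (w z p)))"
      unfolding op_trace_def \<Phi>_def by (rule sum.swap)
    also have "\<dots> = (\<Sum>z\<in>Z. T z z)"
      using norm by (simp flip: sum_distrib_left)
    finally show ?thesis by (simp add: op_trace_def)
  qed
  show "completely_positive_on Z J (diag_algebra Z) \<Phi>"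
    unfolding completely_positive_on_def
  proof (intro allI impI, elim conjE)
    fix n and T :: "(nat \<times> 'z) cmat"
    assume pos: "op_positive ({..<n} \<times> Z) T"
    let ?K = "{..<n}"
    have amp: "ampliate \<Phi> T P Q =
        (\<Sum>z\<in>Z. T (fst P, z) (fst Q, z) * (w z (snd P) * cnj (w z (snd Q))))" for P Q
      by (simp add: ampliate_def \<Phi>_def)
    have "(\<Sum>P\<in>?K\<times>J. \<Sum>Q\<in>?K\<times>J. cnj (v P) * ampliate \<Phi> T P Q * v Q) \<in> \<real>\<^sub>\<ge>\<^sub>0" for v
    proof -
      \<comment> \<open>Contracting \<open>v\<close> with \<open>w z\<close> gives the vector on
        which the block at \<open>z\<close> has to be tested.\<close>
      define u where "u z k = (\<Sum>q\<in>J. cnj (w z q) * v (k, q))" for z k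
      have "(\<Sum>P\<in>?K\<times>J. \<Sum>Q\<in>?K\<times>J. cnj (v P) * ampliate \<Phi> T P Q * v Q) =
          (\<Sum>P\<in>?K\<times>J. \<Sum>Q\<in>?K\<times>J. \<Sum>z\<in>Z.
            (w z (snd P) * cnj (v P)) * T (fst P, z) (fst Q, z) * (cnj (w z (snd Q)) * v Q))"
        by (simp add: amp sum_distrib_left sum_distrib_right mult_ac)
      also have "\<dots> = (\<Sum>z\<in>Z. \<Sum>P\<in>?K\<times>J. \<Sum>Q\<in>?K\<times>J.
            (w z (snd P) * cnj (v P)) * T (fst P, z) (fst Q, z) * (cnj (w z (snd Q)) * v Q))"
        by (subst (2) sum.swap, subst sum.swap) (rule refl)
      also have "\<dots> = (\<Sum>z\<in>Z. \<Sum>k\<in>?K. \<Sum>l\<in>?K. cnj (u z k) * T (k, z) (l, z) * u z l)"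
      proof (rule sum.cong[OF refl])
        fix z
        have u_cnj: "cnj (u z k) = (\<Sum>p\<in>J. w z p * cnj (v (k, p)))" for k
          by (simp add: u_def)
        have expand: "cnj (u z k) * t * u z l =
            (\<Sum>p\<in>J. \<Sum>q\<in>J. (w z p * cnj (v (k, p))) * t * (cnj (w z q) * v (l, q)))" for k l t
          unfolding u_cnj unfolding u_def sum_distrib_right[of _ _ t] sum_product by (rule refl)
        have "(\<Sum>P\<in>?K\<times>J. \<Sum>Q\<in>?K\<times>J.
            (w z (snd P) * cnj (v P)) * T (fst P, z) (fst Q, z) * (cnj (w z (snd Q)) * v Q)) =
            (\<Sum>k\<in>?K. \<Sum>p\<in>J. \<Sum>l\<in>?K. \<Sum>q\<in>J.
              (w z p * cnj (v (k, p))) * T (k, z) (l, z) * (cnj (w z q) * v (l, q)))"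
          unfolding sum_Times fst_conv snd_conv by (rule refl)
        also have "\<dots> = (\<Sum>k\<in>?K. \<Sum>l\<in>?K. \<Sum>p\<in>J. \<Sum>q\<in>J.
              (w z p * cnj (v (k, p))) * T (k, z) (l, z) * (cnj (w z q) * v (l, q)))"
          by (intro sum.cong refl sum.swap)
        also have "\<dots> = (\<Sum>k\<in>?K. \<Sum>l\<in>?K. cnj (u z k) * T (k, z) (l, z) * u z l)"
          unfolding expand by (rule refl)
        finally show "(\<Sum>P\<in>?K\<times>J. \<Sum>Q\<in>?K\<times>J.
            (w z (snd P) * cnj (v P)) * T (fst P, z) (fst Q, z) * (cnj (w z (snd Q)) * v Q)) =
            (\<Sum>k\<in>?K. \<Sum>l\<in>?K. cnj (u z k) * T (k, z) (l, z) * u z l)" .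
      qed
      also have "\<dots> \<in> \<real>\<^sub>\<ge>\<^sub>0"
        using op_positive_block_diagonal[OF fin(1) _ pos, of _ "u _"]
        by (simp add: complex_nonneg_Reals_iff sum_nonneg)
      finally show ?thesis .
    qed
    moreover have "ampliate \<Phi> T \<in> op_algebra (?K \<times> J)"
    proof -
      have "T P Q = 0" if "P \<notin> ?K \<times> Z \<or> Q \<notin> ?K \<times> Z" for P Q
        using pos that unfolding op_positive_def op_algebra_iff by blast
      then show ?thesis
        unfolding op_algebra_iff amp using supp
        by (intro allI impI sum.neutral ballI) (auto simp: mem_Times_iff)
    qed
    ultimately show "op_positive (?K \<times> J) (ampliate \<Phi> T)"
      by (simp add: op_positive_def)
  qed
qed

text \<open>The family \<xi> gives the operator V with V e_k = \<Sum> \<xi>_a(k) e_a, and \<eta>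
  likewise gives W. This is the image under V tensor the entrywise conjugate of W of the maximally
  entangled unit vector, whence the factor 1 / sqrt |I|.\<close>

definition overlap :: "'i set \<Rightarrow> 'a set \<Rightarrow> ('a \<Rightarrow> 'i \<Rightarrow> complex) \<Rightarrow> ('a \<Rightarrow> 'i \<Rightarrow> complex) \<Rightarrow> 'a \<times> 'a \<Rightarrow> complex" where
  "overlap I A \<xi> \<eta> p =
     (if p \<in> A \<times> A then (\<Sum>k\<in>I. \<xi> (fst p) k * cnj (\<eta> (snd p) k)) / sqrt (card I) else 0)"

section \<open>Marginals of overlap vectors\<close>

context
  fixes I :: "'i set" and A :: "'a set"
  assumes fin: "finite I" "finite A"
begin

text \<open>The frame condition makes the operator built from \<xi> an isometry, which cancels when
  its output factor is traced out. The marginal thus depends on \<eta> alone, which is the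
  no-signalling property.\<close>

lemma overlap_marginal_fst:
  assumes frame: "\<And>k l. \<lbrakk>k \<in> I; l \<in> I\<rbrakk> \<Longrightarrow> (\<Sum>a\<in>A. \<xi> a k * cnj (\<xi> a l)) = (if k = l then 1 else 0)"
    and "b \<in> A" "b' \<in> A"
  shows "(\<Sum>a\<in>A. overlap I A \<xi> \<eta> (a, b) * cnj (overlap I A \<xi> \<eta> (a, b'))) =
    (\<Sum>k\<in>I. cnj (\<eta> b k) * \<eta> b' k) / card I"
proof -
  have sq: "complex_of_real (sqrt (card I)) * complex_of_real (sqrt (card I)) = of_nat (card I)"
    by (simp flip: of_real_mult)
  have "overlap I A \<xi> \<eta> (a, b) * cnj (overlap I A \<xi> \<eta> (a, b')) =
      (\<Sum>k\<in>I. \<xi> a k * cnj (\<eta> b k)) * (\<Sum>l\<in>I. cnj (\<xi> a l) * \<eta> b' l) / card I" if "a \<in> A" for a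
    using that assms(2,3) by (simp add: overlap_def sq)
  then have "(\<Sum>a\<in>A. overlap I A \<xi> \<eta> (a, b) * cnj (overlap I A \<xi> \<eta> (a, b'))) =
      (\<Sum>a\<in>A. \<Sum>k\<in>I. \<Sum>l\<in>I. (\<xi> a k * cnj (\<eta> b k)) * (cnj (\<xi> a l) * \<eta> b' l)) / card I"
    by (simp add: sum_divide_distrib sum_product)
  also have "(\<Sum>a\<in>A. \<Sum>k\<in>I. \<Sum>l\<in>I. (\<xi> a k * cnj (\<eta> b k)) * (cnj (\<xi> a l) * \<eta> b' l)) =
      (\<Sum>a\<in>A. \<Sum>k\<in>I. \<Sum>l\<in>I. (\<xi> a k * cnj (\<xi> a l)) * (cnj (\<eta> b k) * \<eta> b' l))"
    by (intro sum.cong refl) (simp add: mult_ac)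
  also have "(\<Sum>a\<in>A. \<Sum>k\<in>I. \<Sum>l\<in>I. (\<xi> a k * cnj (\<xi> a l)) * (cnj (\<eta> b k) * \<eta> b' l)) =
      (\<Sum>k\<in>I. \<Sum>l\<in>I. \<Sum>a\<in>A. (\<xi> a k * cnj (\<xi> a l)) * (cnj (\<eta> b k) * \<eta> b' l))"
    by (subst sum.swap, subst (2) sum.swap) (rule refl)
  also have "\<dots> = (\<Sum>k\<in>I. \<Sum>l\<in>I. if k = l then cnj (\<eta> b k) * \<eta> b' k else 0)"
    by (intro sum.cong refl) (simp add: frame flip: sum_distrib_right)
  also have "\<dots> = (\<Sum>k\<in>I. cnj (\<eta> b k) * \<eta> b' k)"
    using fin by simp
  finally show ?thesis .
qed

lemma overlap_swap: "overlap I A \<eta> \<xi> (b, a) = cnj (overlap I A \<xi> \<eta> (a, b))"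
  by (simp add: overlap_def mult.commute)

text \<open>The squared norm is the trace of the marginal, and the frame condition for \<eta> makes
  that trace |I| / |I|.\<close>

lemma overlap_normalized:
  assumes "I \<noteq> {}"
    and \<xi>: "\<And>k l. \<lbrakk>k \<in> I; l \<in> I\<rbrakk> \<Longrightarrow> (\<Sum>a\<in>A. \<xi> a k * cnj (\<xi> a l)) = (if k = l then 1 else 0)"
    and \<eta>: "\<And>k l. \<lbrakk>k \<in> I; l \<in> I\<rbrakk> \<Longrightarrow> (\<Sum>a\<in>A. \<eta> a k * cnj (\<eta> a l)) = (if k = l then 1 else 0)"
  shows "(\<Sum>p\<in>A\<times>A. overlap I A \<xi> \<eta> p * cnj (overlap I A \<xi> \<eta> p)) = 1"
proof -
  have "(\<Sum>p\<in>A\<times>A. overlap I A \<xi> \<eta> p * cnj (overlap I A \<xi> \<eta> p)) =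
      (\<Sum>a\<in>A. \<Sum>b\<in>A. overlap I A \<xi> \<eta> (a, b) * cnj (overlap I A \<xi> \<eta> (a, b)))"
    by (simp add: sum.cartesian_product split_def)
  also have "\<dots> = (\<Sum>b\<in>A. \<Sum>a\<in>A. overlap I A \<xi> \<eta> (a, b) * cnj (overlap I A \<xi> \<eta> (a, b)))"
    by (rule sum.swap)
  also have "\<dots> = (\<Sum>b\<in>A. \<Sum>k\<in>I. \<eta> b k * cnj (\<eta> b k)) / card I"
    by (simp add: overlap_marginal_fst[OF \<xi>] sum_divide_distrib mult.commute)
  also have "(\<Sum>b\<in>A. \<Sum>k\<in>I. \<eta> b k * cnj (\<eta> b k)) = (\<Sum>k\<in>I. \<Sum>b\<in>A. \<eta> b k * cnj (\<eta> b k))"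
    by (rule sum.swap)
  also have "\<dots> = of_nat (card I)"
    by (simp add: \<eta>)
  finally show ?thesis using assms(1) fin by simp
qed

end

text \<open>
  The rank one choice \<open>g\<^sub>x\<^sub>,\<^sub>a\<^sub>,\<^sub>a\<^sub>' = \<xi>\<^sub>x\<^sub>,\<^sub>a \<xi>\<^sub>x\<^sub>,\<^sub>a\<^sub>'\<^sup>*\<close> in \<open>M\<^sub>I\<close> makes every output state pure, given by the overlaps
  \<open>\<langle>\<xi>\<^sub>x\<^sub>,\<^sub>a, \<xi>\<^sub>y\<^sub>,\<^sub>b\<rangle>\<close>.
\<close>

lemma q_colouring_of_frames:
  fixes G :: "'x pair_pre_digraph" and e :: "'i cmat \<Rightarrow> 'u" and A :: "'a set"
    and \<xi> :: "'x \<Rightarrow> 'a \<Rightarrow> 'i \<Rightarrow> complex"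
  assumes e: "inj e"
    and fin: "finite (pverts G)" "finite I" "finite A" and "I \<noteq> {}"
    and arcs: "parcs G \<subseteq> pverts G \<times> pverts G"
    and supp: "\<And>x a k. k \<notin> I \<Longrightarrow> \<xi> x a k = 0"
    and frame: "\<And>x k l. \<lbrakk>x \<in> pverts G; k \<in> I; l \<in> I\<rbrakk> \<Longrightarrow>
      (\<Sum>a\<in>A. \<xi> x a k * cnj (\<xi> x a l)) = (if k = l then 1 else 0)"
    and orth: "\<And>x y. (x, y) \<in> parcs G \<Longrightarrow> (\<Sum>a\<in>A. \<Sum>k\<in>I. \<xi> x a k * cnj (\<xi> y a k)) = 0"
  shows "\<exists>\<E>. q_colouring TYPE('u) G A \<E>"
proof -
  define X where "X = pverts G"
  define w where "w z = overlap I A (\<xi> (fst z)) (\<xi> (snd z))" for z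
  define \<E> where "\<E> T p q = (\<Sum>z\<in>X\<times>X. T z z * (w z p * cnj (w z q)))" for T :: "('x \<times> 'x) cmat" and p q
  note frame = frame[folded X_def]
  have finX: "finite X" using fin by (simp add: X_def)
  have channel: "channel_on (X \<times> X) (A \<times> A) (diag_algebra (X \<times> X)) \<E>"
    unfolding \<E>_def
  proof (rule channel_on_measure_prepare)
    show "(\<Sum>p\<in>A\<times>A. w z p * cnj (w z p)) = 1" if "z \<in> X \<times> X" for z
      unfolding w_def using that fin \<open>I \<noteq> {}\<close> frame by (intro overlap_normalized) auto
  qed (use finX fin in \<open>auto simp: w_def overlap_def\<close>)
  have out: "cq_output \<E> x y = (\<lambda>p q. w (x, y) p * cnj (w (x, y) q))" if "x \<in> X" "y \<in> X" for x y
  proof (intro ext)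
    fix p q
    have "cq_output \<E> x y p q =
        (\<Sum>z\<in>X\<times>X. if z = (x, y) then w (x, y) p * cnj (w (x, y) q) else 0)"
      unfolding cq_output_def tensor_matrix_unit \<E>_def by (intro sum.cong) (auto simp: matrix_unit_def)
    then show "cq_output \<E> x y p q = w (x, y) p * cnj (w (x, y) q)"
      using that finX by simp
  qed
  have w_outside: "w z p = 0" if "p \<notin> A \<times> A" for z p
    using that by (simp add: w_def overlap_def)
  have ns_fst: "partial_trace_fst A (cq_output \<E> x y) =
      (\<lambda>b b'. if b \<in> A \<and> b' \<in> A then (\<Sum>k\<in>I. cnj (\<xi> y b k) * \<xi> y b' k) / card I else 0)"
    if "x \<in> X" "y \<in> X" for x y
    using that by (auto simp: fun_eq_iff partial_trace_fst_def out w_outside)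
      (auto simp: w_def overlap_marginal_fst[OF fin(2,3) frame])
  have ns_snd: "partial_trace_snd A (cq_output \<E> x y) =
      (\<lambda>a a'. if a \<in> A \<and> a' \<in> A then (\<Sum>k\<in>I. \<xi> x a k * cnj (\<xi> x a' k)) / card I else 0)"
    if "x \<in> X" "y \<in> X" for x y
  proof -
    \<comment> \<open>Exchanging \<open>x\<close> and \<open>y\<close> conjugates the amplitudes, so
      the second marginal is obtained from the first.\<close>
    have swap: "w (x, y) (a, b) = cnj (w (y, x) (b, a))" for a b
      unfolding w_def fst_conv snd_conv by (rule overlap_swap[OF fin(2,3)])
    show ?thesis
    proof (intro ext)
      fix a a'
      have "partial_trace_snd A (cq_output \<E> x y) a a' = (\<Sum>b\<in>A. w (y, x) (b, a') * cnj (w (y, x) (b, a)))"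
        by (simp add: partial_trace_snd_def out that swap mult.commute)
      also have "\<dots> = (if a \<in> A \<and> a' \<in> A then (\<Sum>k\<in>I. cnj (\<xi> x a' k) * \<xi> x a k) / card I else 0)"
      proof (cases "a \<in> A \<and> a' \<in> A")
        case True
        then have "a' \<in> A" "a \<in> A" by auto
        from overlap_marginal_fst[OF fin(2,3) frame[OF that(2)] this, of "\<xi> x"] True
        show ?thesis by (simp add: w_def)
      qed (auto simp: w_outside)
      finally show "partial_trace_snd A (cq_output \<E> x y) a a' =
          (if a \<in> A \<and> a' \<in> A then (\<Sum>k\<in>I. \<xi> x a k * cnj (\<xi> x a' k)) / card I else 0)"
        by (simp add: mult.commute)
    qed
  qed
  have "cqns_correlation X A \<E>"
    unfolding cqns_correlation_def using channel by (simp add: ns_fst ns_snd)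
  moreover have "proper_correlation G A \<E>"
    unfolding proper_correlation_def
  proof (intro allI impI)
    fix x y assume xy: "(x, y) \<in> parcs G"
    then have X: "x \<in> X" "y \<in> X" using arcs by (auto simp: X_def)
    have "(\<Sum>a\<in>A. w (x, y) (a, a)) = (\<Sum>a\<in>A. \<Sum>k\<in>I. \<xi> x a k * cnj (\<xi> y a k)) / sqrt (card I)"
      by (simp add: w_def overlap_def sum_divide_distrib)
    then have "(\<Sum>a\<in>A. w (x, y) (a, a)) = 0"
      using orth[OF xy] by simp
    \<comment> \<open>The output state is pure, so pairing it with \<Omega> gives the squared
      modulus of the sum of its diagonal amplitudes.\<close>
    moreover have "op_pairing (A \<times> A) (cq_output \<E> x y) (Omega A) =
        (\<Sum>a\<in>A. w (x, y) (a, a)) * cnj (\<Sum>a\<in>A. w (x, y) (a, a))"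
      by (simp add: op_pairing_Omega[OF fin(3)] out[OF X] sum_product)
    ultimately show "op_pairing (A \<times> A) (cq_output \<E> x y) (Omega A) = 0"
      by simp
  qed
  moreover have "quantum_tracial_correlation TYPE('u) X A \<E>"
    unfolding quantum_tracial_correlation_def
  proof (intro exI conjI)
    show "finite_dim_algebra (matrix_cstar e I)"
      by (rule finite_dim_matrix_cstar[OF e fin(2)])
    define R where "R x a a' = (\<lambda>k l. \<xi> x a k * cnj (\<xi> x a' l))" for x a a'
    have R: "R x a a' \<in> op_algebra I" for x a a'
      using supp by (auto simp: R_def op_algebra_iff)
    note simps = matrix_cstar_simps[OF e fin(2)]
    note finsum = matrix_cstar_finsum[OF e fin(2)]
    have pos: "positive_matrix_over (matrix_cstar e I) A (\<lambda>a a'. e (R x a a'))" for x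
    proof -
      obtain i0 where i0: "i0 \<in> I" using \<open>I \<noteq> {}\<close> by blast
      \<comment> \<open>A factorisation whose rows are all equal: \<open>H a\<close> is e_{i0}
        \<xi>_a^* / sqrt |A|, so the |A| summands H_a^* H_{a'} add up to \<xi>_a
        \<xi>_{a'}^*.\<close>
      define H where "H a = (\<lambda>k l. if k = i0 then cnj (\<xi> x a l) / sqrt (card A) else 0)" for a
      have H: "H a \<in> op_algebra I" for a
        using supp i0 by (auto simp: H_def op_algebra_iff)
      have "e (R x a a') = (\<Oplus>\<^bsub>matrix_cstar e I\<^esub> b\<in>A. adj (matrix_cstar e I) (e (H a)) \<otimes>\<^bsub>matrix_cstar e I\<^esub> e (H a'))"
        if a: "a \<in> A" for a a'
      proof -
        have sq: "complex_of_real (sqrt (card A)) * complex_of_real (sqrt (card A)) = of_nat (card A)"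
          by (simp flip: of_real_mult)
        have "op_mult I (op_adj (H a)) (H a') k l =
            (\<Sum>j\<in>I. if j = i0 then \<xi> x a k * cnj (\<xi> x a' l) / card A else 0)" for k l
          unfolding op_mult_def op_adj_def H_def by (intro sum.cong) (auto simp: sq)
        then have "op_mult I (op_adj (H a)) (H a') k l = \<xi> x a k * cnj (\<xi> x a' l) / card A" for k l
          using i0 fin by simp
        moreover have "card A \<noteq> 0" using a fin by auto
        ultimately show ?thesis
          using fin H by (simp add: simps finsum op_mult_closed op_algebra_closed R_def)
      qed
      then show ?thesis
        unfolding positive_matrix_over_def using H
        by (intro exI[of _ "\<lambda>b a. e (H a)"]) (auto simp: simps(1))
    qed
    have unit: "(\<Oplus>\<^bsub>matrix_cstar e I\<^esub> a\<in>A. e (R x a a)) = \<one>\<^bsub>matrix_cstar e I\<^esub>" if "x \<in> X" for x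
    proof -
      have "(\<Sum>a\<in>A. R x a a k l) = op_id I k l" for k l
        using frame[OF that, of k l] supp by (cases "k \<in> I"; cases "l \<in> I") (auto simp: R_def op_id_def)
      then show ?thesis
        using fin R by (simp add: simps finsum)
    qed
    \<comment> \<open>The trace of a product of two rank one operators is a product of two inner
      products, here two conjugate-paired overlaps.\<close>
    have "matrix_trace e I (e (R x a a') \<otimes>\<^bsub>matrix_cstar e I\<^esub> e (R y b' b)) = w (x, y) (a, b) * cnj (w (x, y) (a', b'))"
      if "a \<in> A" "a' \<in> A" "b \<in> A" "b' \<in> A" for x y a a' b b'
    proof -
      have sq: "complex_of_real (sqrt (card I)) * complex_of_real (sqrt (card I)) = of_nat (card I)"
        by (simp flip: of_real_mult)
      have "w (x, y) (a, b) * cnj (w (x, y) (a', b')) =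
          (\<Sum>k\<in>I. \<Sum>j\<in>I. \<xi> x a k * cnj (\<xi> y b k) * (cnj (\<xi> x a' j) * \<xi> y b' j)) / card I"
        using that by (simp add: w_def overlap_def sum_product sq)
      also have "\<dots> = op_trace I (op_mult I (R x a a') (R y b' b)) / card I"
        by (simp add: op_trace_def op_mult_def R_def mult_ac)
      finally show ?thesis
        by (simp add: simps matrix_trace_image[OF e fin(2)])
    qed
    then have "cq_output \<E> x y = (\<lambda>p q. \<Sum>a\<in>A. \<Sum>a'\<in>A. \<Sum>b\<in>A. \<Sum>b'\<in>A.
        matrix_trace e I (e (R x a a') \<otimes>\<^bsub>matrix_cstar e I\<^esub> e (R y b' b)) *
          tensor (matrix_unit a a') (matrix_unit b b') p q)" if "x \<in> X" "y \<in> X" for x y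
      using that by (auto simp: fun_eq_iff sum_tensor_matrix_unit[OF fin(3)] out w_outside)
    with pos unit show "tracial_realisation (matrix_cstar e I) (matrix_trace e I) X A \<E>"
      unfolding tracial_realisation_def
      using unital_cstar_algebra_matrix_cstar[OF e fin(2)]
        tracial_state_matrix_trace[OF e fin(2) \<open>I \<noteq> {}\<close>]
      by (intro conjI exI[of _ "\<lambda>x a a'. e (R x a a')"]) auto
  qed
  ultimately show ?thesis
    unfolding q_colouring_def X_def by blast
qed

section \<open>Weyl frames and the two bounds\<close>

text \<open>
  The vectors \<open>U e\<^sub>a\<close>, where \<open>U\<close> is the Heisenberg-Weyl unitary shifting by \<open>fst z\<close> and modulating
  by \<open>snd z\<close>; the \<open>d\<^sup>2\<close> unitaries of this form are pairwise trace-orthogonal.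
\<close>

definition weyl_frame :: "nat \<Rightarrow> nat \<times> nat \<Rightarrow> nat \<Rightarrow> nat \<Rightarrow> complex" where
  "weyl_frame d z a k =
     (if k < d \<and> k = (a + fst z) mod d then cis (2 * pi * real (snd z) / real d) ^ a else 0)"

section \<open>Trace orthogonality of the Weyl unitaries\<close>

lemma shift_mod_inj_on: "inj_on (\<lambda>a. (a + p) mod d) {..<d :: nat}"
proof -
  have "a = b" if "a \<le> b" "b < d" "(b + p) mod d = (a + p) mod d" for a b
  proof -
    have "d dvd (b + p) - (a + p)"
      using that by (intro mod_eq_dvd_iff_nat[THEN iffD1]) auto
    then show ?thesis using that by (auto dest!: dvd_imp_le)
  qed
  then show ?thesis
    by (intro inj_onI) (metis lessThan_iff nle_le)
qed

lemma shift_mod_bij_betw: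
  assumes "d > (0 :: nat)"
  shows "bij_betw (\<lambda>a. (a + p) mod d) {..<d} {..<d}"
  unfolding bij_betw_def
  by (intro conjI shift_mod_inj_on endo_inj_surj) (use assms in auto)

text \<open>Shifting modulo \<open>d\<close> permutes the basis and the phases have modulus one, so
  the vectors form an orthonormal basis.\<close>

lemma weyl_frame_complete:
  assumes "k < d" "l < d"
  shows "(\<Sum>a<d. weyl_frame d z a k * cnj (weyl_frame d z a l)) = (if k = l then 1 else 0)"
proof -
  have unit: "cis t ^ a * cnj (cis t ^ a) = 1" for t a
    by (simp add: Complex.DeMoivre cis_cnj cis_mult)
  have "(\<Sum>a<d. weyl_frame d z a k * cnj (weyl_frame d z a l)) =
      (\<Sum>a<d. (\<lambda>j. if j = k then if k = l then 1 else 0 else 0) ((a + fst z) mod d))"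
    using assms unit by (intro sum.cong) (auto simp: weyl_frame_def)
  also have "\<dots> = (\<Sum>j<d. if j = k then if k = l then 1 else 0 else 0)"
    using assms by (intro sum.reindex_bij_betw shift_mod_bij_betw) auto
  finally show ?thesis using assms by simp
qed

text \<open>With different shifts, corresponding vectors have disjoint supports. With equal shifts,
  the sum is a geometric series over \<open>d\<close> terms whose ratio is a \<open>d\<close>-th
  root of unity other than 1.\<close>

lemma weyl_frame_orthogonal:
  assumes "z \<noteq> z'" "z \<in> {..<d} \<times> {..<d}" "z' \<in> {..<d} \<times> {..<d}"
  shows "(\<Sum>a<d. \<Sum>k<d. weyl_frame d z a k * cnj (weyl_frame d z' a k)) = 0"
proof -
  obtain p q p' q' where z: "z = (p, q)" "z' = (p', q')"
    by (cases z; cases z')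
  then have bounds: "p < d" "q < d" "p' < d" "q' < d" using assms by auto
  then have d: "d > 0" by simp
  define \<omega> where "\<omega> k = cis (2 * pi * real k / real d)" for k
  have "(\<Sum>k<d. weyl_frame d z a k * cnj (weyl_frame d z' a k)) =
      (\<Sum>k<d. if k = (a + p) mod d then if (a + p) mod d = (a + p') mod d
        then (\<omega> q * cnj (\<omega> q')) ^ a else 0 else 0)" for a
    by (intro sum.cong) (auto simp: weyl_frame_def z \<omega>_def power_mult_distrib)
  then have inner: "(\<Sum>k<d. weyl_frame d z a k * cnj (weyl_frame d z' a k)) =
      (if (a + p) mod d = (a + p') mod d then (\<omega> q * cnj (\<omega> q')) ^ a else 0)" for a
    using d by simp
  show ?thesis
  proof (cases "p = p'")
    case False
    \<comment> \<open>Shift injectivity with exchanged roles: \<open>a\<close> is the shift, and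
      \<open>p\<close>, \<open>p'\<close> are the shifted points.\<close>
    have "(a + p) mod d \<noteq> (a + p') mod d" for a
      using inj_onD[OF shift_mod_inj_on[of a d], of p p'] False bounds by (auto simp: add.commute)
    then show ?thesis by (simp add: inner)
  next
    case True
    with assms z have "q \<noteq> q'" by auto
    have root: "\<omega> k ^ d = 1" for k
    proof -
      have "\<omega> k ^ d = cis (2 * pi * real k)" using d by (simp add: \<omega>_def Complex.DeMoivre)
      then show ?thesis by (simp add: cis_multiple_2pi)
    qed
    have unit: "\<omega> k * cnj (\<omega> k) = 1" for k
      by (simp add: \<omega>_def cis_cnj cis_mult)
    have "\<omega> q \<noteq> \<omega> q'"
      using inj_onD[OF bij_betw_imp_inj_on[OF Complex.bij_betw_roots_unity[OF d]], of q q'] \<open>q \<noteq> q'\<close> bounds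
      by (auto simp: \<omega>_def)
    then have ne: "\<omega> q * cnj (\<omega> q') \<noteq> 1"
      using unit[of q'] by (metis mult.assoc mult.commute mult_1)
    have "(\<omega> q * cnj (\<omega> q')) ^ d = 1"
      by (simp add: power_mult_distrib root flip: complex_cnj_power)
    then show ?thesis
      using geometric_sum[OF ne, of d] True by (simp add: inner)
  qed
qed

text \<open>An injection of the vertices into the labels of the Weyl unitaries assigns
  trace-orthogonal unitaries to all distinct vertices. Besides complete graphs, this serves to show
  that the minimum defining \<open>xi_qc\<close> is attained.\<close>

lemma q_colouring_exists:
  fixes G :: "'x pair_pre_digraph"
  assumes universe: "(UNIV :: real set) \<lesssim> (UNIV :: 'u set)"
    and fin: "finite (pverts G)"
    and arcs: "parcs G \<subseteq> pverts G \<times> pverts G" "\<And>x. (x, x) \<notin> parcs G"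
    and card: "card (pverts G) \<le> d\<^sup>2"
  shows "\<exists>\<E>. q_colouring TYPE('u) G {..<d} \<E>"
proof -
  obtain e :: "nat cmat \<Rightarrow> 'u" where e: "inj e"
    using nat_cmat_embedding[OF universe] by blast
  show ?thesis
  \<comment> \<open>For \<open>d = 0\<close> there are no vertices; the index set {0} replaces the
    empty {..<d}, on which no normalised trace exists.\<close>
  proof (cases "d = 0")
    case True
    then have "pverts G = {}" using fin card by simp
    then show ?thesis
      using q_colouring_of_frames[OF e, of G "{0}" "{..<d}" "\<lambda>_ _ _. 0"] arcs by auto
  next
    case False
    have "card (pverts G) \<le> card ({..<d} \<times> {..<d})"
      using card by (simp add: power2_eq_square)
    then obtain f where f: "f ` pverts G \<subseteq> {..<d} \<times> {..<d}" "inj_on f (pverts G)"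
      using card_le_inj[OF fin, of "{..<d} \<times> {..<d}"] by auto
    show ?thesis
    proof (rule q_colouring_of_frames[OF e fin])
      show "(\<Sum>a<d. \<Sum>k<d. weyl_frame d (f x) a k * cnj (weyl_frame d (f y) a k)) = 0"
        if "(x, y) \<in> parcs G" for x y
      proof (rule weyl_frame_orthogonal)
        show "f x \<noteq> f y" using that arcs f(2) by (auto dest: inj_onD)
      qed (use that arcs f(1) in auto)
    qed (use False arcs(1) in \<open>auto simp: weyl_frame_complete\<close>, auto simp: weyl_frame_def)
  qed
qed

section \<open>Lower bounds on the number of colours\<close>

lemma q_colouring_imp_qc_colouring: "q_colouring U G A \<E> \<Longrightarrow> qc_colouring U G A \<E>"
  unfolding q_colouring_def qc_colouring_def quantum_tracial_correlation_def tracial_correlation_def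
  by blast

lemma qc_colouring_bound:
  assumes col: "qc_colouring TYPE('u) G A \<E>" and fin: "finite A" "finite (pverts G)"
    and u: "orthonormal_representation G n u" and c: "dot_prod n c c = 1"
  shows "(\<Sum>x\<in>pverts G. (dot_prod n c (u x))\<^sup>2) \<le> (card A)\<^sup>2"
proof -
  obtain \<A> :: "'u cstar_struct" and \<tau> where real: "tracial_realisation \<A> \<tau> (pverts G) A \<E>"
    using col unfolding qc_colouring_def tracial_correlation_def by blast
  then obtain g where pos: "\<And>x. x \<in> pverts G \<Longrightarrow> positive_matrix_over \<A> A (g x)"
    and unit: "\<And>x. x \<in> pverts G \<Longrightarrow> (\<Oplus>\<^bsub>\<A>\<^esub> a\<in>A. g x a a) = \<one>\<^bsub>\<A>\<^esub>"
    and out: "\<And>x y. \<lbrakk>x \<in> pverts G; y \<in> pverts G\<rbrakk> \<Longrightarrow> cq_output \<E> x y =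
        (\<lambda>p q. \<Sum>a\<in>A. \<Sum>a'\<in>A. \<Sum>b\<in>A. \<Sum>b'\<in>A.
          \<tau> (g x a a' \<otimes>\<^bsub>\<A>\<^esub> g y b' b) * tensor (matrix_unit a a') (matrix_unit b b') p q)"
    unfolding tracial_realisation_def by blast
  interpret tracial_cstar_algebra \<A> \<tau>
    using real unfolding tracial_realisation_def tracial_cstar_algebra_def
      tracial_cstar_algebra_axioms_def by blast
  show ?thesis
  proof (rule bessel_orthonormal_representation[OF fin(2,1) pos unit c])
    show "dot_prod n (u x) (u x) = 1" if "x \<in> pverts G" for x
      using u that by (simp add: orthonormal_representation_def)
    fix x y assume xy: "x \<in> pverts G" "y \<in> pverts G" "x \<noteq> y"
    show "dot_prod n (u x) (u y) = 0 \<or> (\<Sum>a\<in>A. \<Sum>a'\<in>A. \<tau> (g x a a' \<otimes>\<^bsub>\<A>\<^esub> g y a' a)) = 0"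
    proof (cases "(x, y) \<in> parcs G")
      case True
      then have "op_pairing (A \<times> A) (cq_output \<E> x y) (Omega A) = 0"
        using col by (simp add: qc_colouring_def proper_correlation_def)
      then show ?thesis
        by (simp add: op_pairing_Omega[OF fin(1)] out[OF xy(1,2)] sum_tensor_matrix_unit[OF fin(1)])
    qed (use u xy in \<open>simp add: orthonormal_representation_def\<close>)
  qed
qed

text \<open>Without distinct non-adjacent vertices, the constant representation in dimension one is
  admissible, and with the constant handle every vertex contributes exactly 1.\<close>

lemma qc_colouring_card_complete:
  assumes "qc_colouring TYPE('u) G A \<E>" "finite A" "finite (pverts G)"
    and "\<And>x y. \<lbrakk>x \<in> pverts G; y \<in> pverts G; x \<noteq> y\<rbrakk> \<Longrightarrow> (x, y) \<in> parcs G"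
  shows "card (pverts G) \<le> (card A)\<^sup>2"
proof -
  have "(\<Sum>x\<in>pverts G. (dot_prod 1 (\<lambda>_. 1) (\<lambda>_. 1))\<^sup>2) \<le> real ((card A)\<^sup>2)"
    using assms
    by (intro qc_colouring_bound[where u = "\<lambda>_ _. 1"])
      (auto simp: orthonormal_representation_def dot_prod_def)
  then have "real (card (pverts G)) \<le> real ((card A)\<^sup>2)"
    by (simp add: dot_prod_def)
  then show ?thesis by (simp only: of_nat_le_iff)
qed

text \<open>An orthonormal basis with the uniform unit vector as handle. It ensures that the infimum
  defining \<open>lovasz_number\<close> is taken over a nonempty set.\<close>

lemma orthonormal_representation_exists:
  assumes "finite (pverts G)" "pverts G \<noteq> {}"
  shows "\<exists>n u c. orthonormal_representation G n u \<and> dot_prod n c c = 1 \<and>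
    (\<forall>x\<in>pverts G. dot_prod n c (u x) \<noteq> 0)"
proof -
  let ?N = "card (pverts G)"
  have N: "?N > 0" using assms by (simp add: card_gt_0_iff)
  obtain h where h: "bij_betw h (pverts G) {..<?N}"
    using ex_bij_betw_finite_nat[OF assms(1)] by (auto simp: atLeast0LessThan)
  define u where "u x k = (if k = h x then 1 else 0 :: real)" for x k
  define c :: "nat \<Rightarrow> real" where "c k = 1 / sqrt ?N" for k
  have dot_u: "dot_prod ?N v (u x) = v (h x)" if "x \<in> pverts G" for v x
    using h that by (auto simp: dot_prod_def u_def if_distrib bij_betw_def cong: if_cong)
  have "orthonormal_representation G ?N u"
    unfolding orthonormal_representation_def
    using h by (auto simp: dot_u) (auto simp: u_def bij_betw_def dest: inj_onD)
  moreover have "dot_prod ?N c c = 1"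
    using N by (simp add: dot_prod_def c_def)
  ultimately show ?thesis
    using N by (intro exI[of _ ?N] exI[of _ u] exI[of _ c]) (auto simp: dot_u c_def)
qed

text \<open>For a representation of value \<open>s\<close>, every vertex satisfies 1 \<le> s <c,
  u_x>^2. Summing and applying the Bessel bound gives |X| \<le> |A|^2 s, and then the infimum over
  \<open>s\<close> is taken.\<close>

lemma qc_colouring_lovasz_bound:
  assumes col: "qc_colouring TYPE('u) G A \<E>" and fin: "finite A" "finite (pverts G)"
  shows "sqrt (real (card (pverts G)) / lovasz_number G) \<le> real (card A)"
proof (cases "pverts G = {}")
  case False
  let ?N = "real (card (pverts G))" and ?m = "real (card A)"
  have N: "?N > 0" using False fin by (simp add: card_gt_0_iff)
  define V where "V = {Max ((\<lambda>x. 1 / (dot_prod n c (u x))\<^sup>2) ` pverts G) | n u c.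
            orthonormal_representation G n u \<and> dot_prod n c c = 1 \<and>
            (\<forall>x\<in>pverts G. dot_prod n c (u x) \<noteq> 0)}"
  have ge: "?N \<le> ?m\<^sup>2 * s" if s_mem: "s \<in> V" for s
  proof -
    obtain n u c where s: "s = Max ((\<lambda>x. 1 / (dot_prod n c (u x))\<^sup>2) ` pverts G)"
      and u: "orthonormal_representation G n u" and c: "dot_prod n c c = 1"
      and nz: "\<forall>x\<in>pverts G. dot_prod n c (u x) \<noteq> 0"
      using s_mem unfolding V_def by blast
    have le: "1 / (dot_prod n c (u x))\<^sup>2 \<le> s" if "x \<in> pverts G" for x
      unfolding s using that fin by (intro Max_ge) auto
    obtain x0 where "x0 \<in> pverts G" using False by blast
    then have "s > 0" using le nz by (meson less_le_trans zero_less_divide_1_iff zero_less_power2)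
    have "1 \<le> s * (dot_prod n c (u x))\<^sup>2" if "x \<in> pverts G" for x
      using le[OF that] nz that by (simp add: field_simps)
    then have "?N \<le> (\<Sum>x\<in>pverts G. s * (dot_prod n c (u x))\<^sup>2)"
      using sum_mono[of "pverts G" "\<lambda>_. 1 :: real"] by simp
    also have "\<dots> \<le> s * ?m\<^sup>2"
      using qc_colouring_bound[OF col fin u c] \<open>s > 0\<close>
      by (simp flip: sum_distrib_left)
    finally show ?thesis by (simp add: mult.commute)
  qed
  have V: "V \<noteq> {}"
    using orthonormal_representation_exists[OF fin(2) False] unfolding V_def by blast
  \<comment> \<open>With no colours, any member of \<open>V\<close> would give
    \<open>?N \<le> 0\<close>.\<close>
  have "?m \<noteq> 0"
    using ge V N by fastforce
  then have m: "?m\<^sup>2 > 0" by simp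
  have "?N / ?m\<^sup>2 \<le> Inf V"
    using V ge m by (intro cInf_greatest) (auto simp: field_simps)
  then have le: "?N / ?m\<^sup>2 \<le> lovasz_number G"
    by (simp add: lovasz_number_def V_def)
  moreover have "?N / ?m\<^sup>2 > 0" using N m by simp
  \<comment> \<open>Positivity is needed to move \<open>lovasz_number G\<close> into the
    denominator.\<close>
  ultimately have "lovasz_number G > 0" by linarith
  then have "?N / lovasz_number G \<le> ?m\<^sup>2"
    using le m by (simp add: field_simps)
  then show ?thesis by (intro real_le_lsqrt) auto
qed simp

theorem proposition10p5:
  fixes G :: "'x pair_pre_digraph"
  assumes universe: "(UNIV :: real set) \<lesssim> (UNIV :: 'u set)"
    and graph: "pair_graph G"
  shows "real (xi_qc TYPE('u) G) \<ge> sqrt (real (card (pverts G)) / lovasz_number G) \<and>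
         (\<forall>(d :: nat) (K :: 'y pair_pre_digraph). complete_digraph (d\<^sup>2) (with_proj K) \<longrightarrow>
            xi_q TYPE('u) K = d \<and> xi_qc TYPE('u) K = d)"
proof (intro conjI allI impI)
  interpret G: pair_graph G by (rule graph)
  have fin: "finite (pverts G)" by (rule G.pair_finite_verts)
  \<comment> \<open>As many colours as vertices suffice. This makes the set under
    \<open>LEAST\<close> nonempty, so that \<open>xi_qc\<close> is the size of an actual
    colouring.\<close>
  have "card (pverts G) \<le> (card (pverts G))\<^sup>2"
    by (simp add: power2_eq_square)
  then obtain \<E> where col: "q_colouring TYPE('u) G {..<card (pverts G)} \<E>"
    using q_colouring_exists[OF universe fin, of "card (pverts G)"]
      G.arc_fst_in_verts G.arc_snd_in_verts G.pair_no_loops by fastforce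
  have "\<exists>(A :: nat set) \<E>. finite A \<and> card A = card (pverts G) \<and> qc_colouring TYPE('u) G A \<E>"
    using q_colouring_imp_qc_colouring[OF col]
    by (intro exI[of _ "{..<card (pverts G)}"] exI[of _ \<E>]) simp
  then have "\<exists>(A :: nat set) \<E>. finite A \<and> card A = xi_qc TYPE('u) G \<and> qc_colouring TYPE('u) G A \<E>"
    unfolding xi_qc_def by (rule LeastI)
  then show "sqrt (real (card (pverts G)) / lovasz_number G) \<le> real (xi_qc TYPE('u) G)"
    using qc_colouring_lovasz_bound[OF _ _ fin] by metis
next
  fix d and K :: "'y pair_pre_digraph"
  assume K: "complete_digraph (d\<^sup>2) (with_proj K)"
  interpret graph "with_proj K" using K by (simp add: complete_digraph_def)
  have fin: "finite (pverts K)" using finite_verts by simp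
  have card: "card (pverts K) = d\<^sup>2"
    and arcs: "parcs K = {(u, v). (u, v) \<in> pverts K \<times> pverts K \<and> u \<noteq> v}"
    using K by (simp_all add: complete_digraph_def)
  obtain \<E> where col: "q_colouring TYPE('u) K {..<d} \<E>"
    using q_colouring_exists[OF universe fin, of d] card arcs by fastforce
  \<comment> \<open>Stated for qc-colourings, the bound also covers q-colourings, so both minima
    equal \<open>d\<close>.\<close>
  have least: "d \<le> n" if "finite A" "card A = n" "qc_colouring TYPE('u) K A \<E>" for n and A :: "nat set" and \<E>
    using qc_colouring_card_complete[OF that(3,1) fin] arcs card that(2)
    by (simp add: power2_nat_le_eq_le)
  show "xi_q TYPE('u) K = d"
    unfolding xi_q_def
  proof (rule Least_equality)
    show "\<exists>(A :: nat set) \<E>. finite A \<and> card A = d \<and> q_colouring TYPE('u) K A \<E>"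
      using col by (intro exI[of _ "{..<d}"] exI[of _ \<E>]) simp
  qed (use least q_colouring_imp_qc_colouring in blast)
  show "xi_qc TYPE('u) K = d"
    unfolding xi_qc_def
  proof (rule Least_equality)
    show "\<exists>(A :: nat set) \<E>. finite A \<and> card A = d \<and> qc_colouring TYPE('u) K A \<E>"
      using q_colouring_imp_qc_colouring[OF col] by (intro exI[of _ "{..<d}"] exI[of _ \<E>]) simp
  qed (use least in blast)
qed

end
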